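(* Let $\mathbf{A}_1\in\mathbb{H}^{m\times n}_{r_1}$, $\mathbf{A}_2\in\mathbb{H}^{m\times p}_{r_2}$, $\mathbf{C}\in\mathbb{H}^{m\times r}$, let $\mathbf{M}=\mathbf{R}_{A_1}\mathbf{A}_2$ with $\operatorname{rank}\mathbf{M}=r_4$, and let $\mathbf{X}_1=\mathbf{A}_1^\dagger\mathbf{C}-\mathbf{A}_1^\dagger\mathbf{A}_2\mathbf{M}^\dagger\mathbf{C}=(x^{(1)}_{ij})\in\mathbb{H}^{n\times r}$ and $\mathbf{X}_2=\mathbf{M}^\dagger\mathbf{C}=(x^{(2)}_{gf})\in\mathbb{H}^{p\times r}$. Let $\tilde{\mathbf{a}}^{(2)}_{.t}$ be the $t$th column of $\mathbf{A}_1^*\mathbf{A}_2$, and let $\mathbf{c}^{(1)}_{.j}$, $\mathbf{c}^{(2)}_{.j}$ be the $j$th columns of $\mathbf{C}_1=\mathbf{A}_1^*\mathbf{C}$ and $\mathbf{C}_2=\mathbf{M}^*\mathbf{C}$. Then $$x^{(1)}_{ij}=\frac{\sum_{\beta\in J_{r_1,n}\{i\}}\mathrm{cdet}_i\big((\mathbf{A}_1^*\mathbf{A}_1)_{.i}(\mathbf{c}^{(1)}_{.j})\big)^\beta_\beta}{\sum_{\beta\in J_{r_1,n}}|\mathbf{A}_1^*\mathbf{A}_1|^\beta_\beta}-\frac{\sum_{t=1}^p\sum_{\beta\in J_{r_1,n}\{i\}}\mathrm{cdet}_i\big((\mathbf{A}_1^*\mathbf{A}_1)_{.i}(\tilde{\mathbf{a}}^{(2)}_{.t})\big)^\beta_\beta\sum_{\beta\in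 J_{r_4,p}\{t\}}\mathrm{cdet}_t\big((\mathbf{M}^*\mathbf{M})_{.t}(\mathbf{c}^{(2)}_{.j})\big)^\beta_\beta}{\sum_{\beta\in J_{r_1,n}}|\mathbf{A}_1^*\mathbf{A}_1|^\beta_\beta\sum_{\beta\in J_{r_4,p}}|\mathbf{M}^*\mathbf{M}|^\beta_\beta},$$ $$x^{(2)}_{gf}=\frac{\sum_{\beta\in J_{r_4,p}\{g\}}\mathrm{cdet}_g\big((\mathbf{M}^*\mathbf{M})_{.g}(\mathbf{c}^{(2)}_{.f})\big)^\beta_\beta}{\sum_{\beta\in J_{r_4,p}}|\mathbf{M}^*\mathbf{M}|^\beta_\beta}.$$
   Context: $\mathbb{H}$ is the skew field of real quaternions; $\mathbb{H}^{m\times n}$ is the set of $m\times n$ matrices over $\mathbb{H}$ and $\mathbb{H}^{m\times n}_r$ the subset of those of rank $r$. $\mathbf{A}^*$ is the conjugate transpose and $\mathbf{A}^\dagger$ the Moore–Penrose inverse (the unique $\mathbf{X}$ with $\mathbf{AXA}=\mathbf{A}$, $\mathbf{XAX}=\mathbf{X}$, $(\mathbf{AX})^*=\mathbf{AX}$, $(\mathbf{XA})^*=\mathbf{XA}$). $\mathbf{R}_A=\mathbf{I}-\mathbf{A}\mathbf{A}^\dagger$. For a matrix $\mathbf{F}$, $\mathbf{F}_{.j}(\mathbf{b})$ is $\mathbf{F}$ with its $j$th column replaced by the column $\mathbf{b}$. Column determinants: for $\mathbf{F}=(a_{ij})\in\mathbb{H}^{n\times n}$, $\mathrm{cdet}_j\mathbf{F}=\sum_{\tau\in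 S_n}(-1)^{n-r}(a_{j_{k_r}j_{k_r+l_r}}\cdots a_{j_{k_r+1}j_{k_r}})\cdots(a_{j\,j_{k_1+l_1}}\cdots a_{j_{k_1+1}j_{k_1}}a_{j_{k_1}j})$, where $\tau=(j_{k_r+l_r}\cdots j_{k_r+1}\,j_{k_r})\cdots(j_{k_2+l_2}\cdots j_{k_2})(j_{k_1+l_1}\cdots j_{k_1+1}\,j_{k_1}\,j)$ is the decomposition of $\tau$ into $r$ disjoint cycles (fixed points included) with $j_{k_2}<\cdots<j_{k_r}$ and $j_{k_t}<j_{k_t+s}$ for $t=2,\dots,r$, $s=1,\dots,l_t$. For Hermitian $\mathbf{F}$ all $\mathrm{cdet}_j\mathbf{F}$ coincide and are real; this value is $\det\mathbf{F}$. Index sets: $L_{k,n}$ is the set of strictly increasing sequences $\beta=(\beta_1<\cdots<\beta_k)$ in $\{1,\dots,n\}$; $J_{k,n}\{j\}=\{\beta\in L_{k,n}: j\in\beta\}$; sums over $J_{k,n}$ without braces run over all of $L_{k,n}$. For a square $\mathbf{F}$, $\mathbf{F}^\beta_\beta$ is the principal submatrix with rows and columns indexed by $\beta$; $\mathrm{cdet}_i(\mathbf{G})^\beta_\beta$ is the column determinant of the principal submatrix $\mathbf{G}^\beta_\beta$ taken at the column coming from index $i$; for Hermitian $\mathbf{F}$, $|\mathbf{F}|^\beta_\beta=\det\mathbf{F}^\beta_\beta$. *)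

theory Defs
  imports Complex_Main "HOL-Combinatorics.Permutations"
begin

datatype quat = Quat (qr: real) (qi: real) (qj: real) (qk: real)

lemma quat_eqI: "qr x = qr y \<Longrightarrow> qi x = qi y \<Longrightarrow> qj x = qj y \<Longrightarrow> qk x = qk y \<Longrightarrow> x = y"
  by (cases x; cases y) simp

instantiation quat :: ring_1
begin
definition "0 = Quat 0 0 0 0"
definition "1 = Quat 1 0 0 0"
definition "x + y = Quat (qr x + qr y) (qi x + qi y) (qj x + qj y) (qk x + qk y)"
definition "x - y = Quat (qr x - qr y) (qi x - qi y) (qj x - qj y) (qk x - qk y)"
definition "- x = Quat (- qr x) (- qi x) (- qj x) (- qk x)"
definition "x * y = Quat
   (qr x * qr y - qi x * qi y - qj x * qj y - qk x * qk y)
   (qr x * qi y + qi x * qr y + qj x * qk y - qk x * qj y)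
   (qr x * qj y - qi x * qk y + qj x * qr y + qk x * qi y)
   (qr x * qk y + qi x * qj y - qj x * qi y + qk x * qr y)"
instance
  by standard (auto intro!: quat_eqI simp: zero_quat_def one_quat_def plus_quat_def
      minus_quat_def uminus_quat_def times_quat_def algebra_simps)
end

instantiation quat :: inverse
begin
definition inverse_quat :: "quat \<Rightarrow> quat" where "inverse_quat x = (let d = (qr x)\<^sup>2 + (qi x)\<^sup>2 + (qj x)\<^sup>2 + (qk x)\<^sup>2 in
   Quat (qr x / d) (- qi x / d) (- qj x / d) (- qk x / d))"
definition divide_quat :: "quat \<Rightarrow> quat \<Rightarrow> quat" where "divide_quat x y = x * inverse y"
instance ..
end

definition qcnj :: "quat \<Rightarrow> quat" where
  "qcnj x = Quat (qr x) (- qi x) (- qj x) (- qk x)"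

text \<open>A matrix is a function \<open>nat \<Rightarrow> nat \<Rightarrow> quat\<close>; an m-by-n matrix is read on
  the index box \<open>{..<m} \<times> {..<n}\<close> (0-based indices); entries outside are irrelevant.\<close>

type_synonym qmat = "nat \<Rightarrow> nat \<Rightarrow> quat"

definition qmult :: "nat \<Rightarrow> qmat \<Rightarrow> qmat \<Rightarrow> qmat" where
  "qmult k A B = (\<lambda>i j. \<Sum>l<k. A i l * B l j)"

definition qadj :: "qmat \<Rightarrow> qmat" where
  "qadj A = (\<lambda>i j. qcnj (A j i))"

definition qid :: qmat where
  "qid = (\<lambda>i j. if i = j then 1 else 0)"

definition qdiff :: "qmat \<Rightarrow> qmat \<Rightarrow> qmat" where
  "qdiff A B = (\<lambda>i j. A i j - B i j)"

definition qmat_eq :: "nat \<Rightarrow> nat \<Rightarrow> qmat \<Rightarrow> qmat \<Rightarrow> bool" where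
  "qmat_eq m n A B \<longleftrightarrow> (\<forall>i<m. \<forall>j<n. A i j = B i j)"

definition right_indep_cols :: "nat \<Rightarrow> qmat \<Rightarrow> nat set \<Rightarrow> bool" where
  "right_indep_cols m A K \<longleftrightarrow>
     (\<forall>\<alpha>. (\<forall>i<m. (\<Sum>j\<in>K. A i j * \<alpha> j) = 0) \<longrightarrow> (\<forall>j\<in>K. \<alpha> j = 0))"

definition qrank :: "nat \<Rightarrow> nat \<Rightarrow> qmat \<Rightarrow> nat" where
  "qrank m n A = Max {card K | K. K \<subseteq> {..<n} \<and> right_indep_cols m A K}"

definition is_MP :: "nat \<Rightarrow> nat \<Rightarrow> qmat \<Rightarrow> qmat \<Rightarrow> bool" where
  "is_MP m n A X \<longleftrightarrow>
     qmat_eq m n (qmult m (qmult n A X) A) A \<and>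
     qmat_eq n m (qmult n (qmult m X A) X) X \<and>
     qmat_eq m m (qadj (qmult n A X)) (qmult n A X) \<and>
     qmat_eq n n (qadj (qmult m X A)) (qmult m X A)"

definition qMP :: "nat \<Rightarrow> nat \<Rightarrow> qmat \<Rightarrow> qmat" where
  "qMP m n A = (THE X. is_MP m n A X \<and> (\<forall>i j. (n \<le> i \<or> m \<le> j) \<longrightarrow> X i j = 0))"

definition qR :: "nat \<Rightarrow> nat \<Rightarrow> qmat \<Rightarrow> qmat" where
  "qR m n A = qdiff qid (qmult n A (qMP m n A))"

definition colrep :: "qmat \<Rightarrow> nat \<Rightarrow> (nat \<Rightarrow> quat) \<Rightarrow> qmat" where
  "colrep F j b = (\<lambda>i k. if k = j then b i else F i k)"

definition col :: "qmat \<Rightarrow> nat \<Rightarrow> nat \<Rightarrow> quat" where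
  "col F j = (\<lambda>i. F i j)"

definition cyc_len :: "(nat \<Rightarrow> nat) \<Rightarrow> nat \<Rightarrow> nat" where
  "cyc_len \<tau> x = (LEAST k. 0 < k \<and> (\<tau> ^^ k) x = x)"

definition orb :: "(nat \<Rightarrow> nat) \<Rightarrow> nat \<Rightarrow> nat set" where
  "orb \<tau> x = {(\<tau> ^^ k) x | k. True}"

definition cyc_prod :: "qmat \<Rightarrow> (nat \<Rightarrow> nat) \<Rightarrow> nat \<Rightarrow> quat" where
  "cyc_prod a \<tau> x = prod_list (map (\<lambda>s. a ((\<tau> ^^ s) x) ((\<tau> ^^ Suc s) x)) [0..<cyc_len \<tau> x])"

definition other_heads :: "nat set \<Rightarrow> (nat \<Rightarrow> nat) \<Rightarrow> nat \<Rightarrow> nat set" where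
  "other_heads S \<tau> j = {x \<in> S. x = Min (orb \<tau> x) \<and> x \<notin> orb \<tau> j}"

text \<open>Column determinant \<open>cdet_j\<close> of the square matrix with rows and columns indexed by the
  finite set S (in increasing order), entries taken from a.  The cycle through j is placed
  last (rightmost); the other cycles, each starting at its least element, appear from left
  to right with decreasing leading elements.\<close>
definition cdet :: "nat set \<Rightarrow> qmat \<Rightarrow> nat \<Rightarrow> quat" where
  "cdet S a j = (\<Sum>\<tau> \<in> {\<tau>. \<tau> permutes S}.
      (- 1) ^ (card S - (card (other_heads S \<tau> j) + 1)) *
      (prod_list (map (cyc_prod a \<tau>) (rev (sorted_list_of_set (other_heads S \<tau> j))))
        * cyc_prod a \<tau> j))"

text \<open>Determinant of a Hermitian principal submatrix \<open>|F|^\<beta>_\<beta>\<close> (all cdet coincide; we take the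
  column at the least index; the empty principal minor is 1).\<close>
definition hdet :: "nat set \<Rightarrow> qmat \<Rightarrow> quat" where
  "hdet S a = (if S = {} then 1 else cdet S a (Min S))"

definition Lkn :: "nat \<Rightarrow> nat \<Rightarrow> nat set set" where
  "Lkn k n = {\<beta>. \<beta> \<subseteq> {..<n} \<and> card \<beta> = k}"

definition Jkn :: "nat \<Rightarrow> nat \<Rightarrow> nat \<Rightarrow> nat set set" where
  "Jkn k n i = {\<beta> \<in> Lkn k n. i \<in> \<beta>}"

end

theory Submission
  imports Defs "HOL-Combinatorics.Cycles"
begin

text \<open>
  Splitting off the cycle through \<open>j\<close> turns \<open>cdet\<^sub>j\<close> into a signed sum over the simple paths that
  start at \<open>j\<close>, weighted by determinants of the complementary principal submatrices. For a
  Hermitian matrix, induction along this expansion shows that all \<open>cdet\<^sub>j\<close> coincide and are real,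
  and that Cramer's rule holds. Let \<open>G = A\<^sup>* A\<close>, let \<open>d\<^sub>k\<close> be the sum of its principal minors of
  order \<open>k\<close>, and let \<open>N\<^sub>k\<close> be the matrix representing
  \<open>c \<mapsto> (\<Sum>\<beta>\<in>J\<^sub>k{i}. cdet\<^sub>i (G\<^sub>.\<^sub>i(c))\<^sub>\<beta>)\<^sub>i\<close>. A cancellation of paths gives
  \<open>N\<^sub>k\<^sub>+\<^sub>1 = d\<^sub>k I - N\<^sub>k G\<close>, so every \<open>N\<^sub>k\<close> is a real polynomial in \<open>G\<close>. If \<open>A\<close> has rank \<open>r\<close>, then
  \<open>d\<^sub>r > 0\<close> and \<open>d\<^sub>k = 0\<close> for \<open>k > r\<close>; descending from \<open>N\<^sub>n\<^sub>+\<^sub>1 = 0\<close> gives \<open>N\<^sub>r\<^sub>+\<^sub>1 G = 0\<close>, that is,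
  \<open>N\<^sub>r G\<^sup>2 = d\<^sub>r G\<close>. Hence \<open>N\<^sub>r A\<^sup>* / d\<^sub>r\<close> satisfies the Penrose equations, which proves both the
  existence of the Moore--Penrose inverse and its determinantal representation.
\<close>

section \<open>Quaternions\<close>

text \<open>Principal minors of Hermitian matrices will turn out to be real. Carried as
  \<open>scaleR\<close> coefficients, they move freely through noncommutative products.\<close>

instantiation quat :: real_algebra_1
begin
definition "c *\<^sub>R x = Quat (c * qr x) (c * qi x) (c * qj x) (c * qk x)"
instance
  by standard (auto intro!: quat_eqI simp: scaleR_quat_def zero_quat_def one_quat_def plus_quat_def
      times_quat_def algebra_simps)
end

lemma quat_sel [simp]:
  "qr 0 = 0" "qi 0 = 0" "qj 0 = 0" "qk 0 = 0"
  "qr 1 = 1" "qi 1 = 0" "qj 1 = 0" "qk 1 = 0"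
  "qr (x + y) = qr x + qr y" "qi (x + y) = qi x + qi y"
  "qj (x + y) = qj x + qj y" "qk (x + y) = qk x + qk y"
  "qr (x - y) = qr x - qr y" "qi (x - y) = qi x - qi y"
  "qj (x - y) = qj x - qj y" "qk (x - y) = qk x - qk y"
  "qr (- x) = - qr x" "qi (- x) = - qi x" "qj (- x) = - qj x" "qk (- x) = - qk x"
  "qr (c *\<^sub>R x) = c * qr x" "qi (c *\<^sub>R x) = c * qi x"
  "qj (c *\<^sub>R x) = c * qj x" "qk (c *\<^sub>R x) = c * qk x"
  by (simp_all add: zero_quat_def one_quat_def plus_quat_def minus_quat_def uminus_quat_def
      scaleR_quat_def)

lemma quat_sel_mult:
  "qr (x * y) = qr x * qr y - qi x * qi y - qj x * qj y - qk x * qk y"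
  "qi (x * y) = qr x * qi y + qi x * qr y + qj x * qk y - qk x * qj y"
  "qj (x * y) = qr x * qj y - qi x * qk y + qj x * qr y + qk x * qi y"
  "qk (x * y) = qr x * qk y + qi x * qj y - qj x * qi y + qk x * qr y"
  by (simp_all add: times_quat_def)

lemma qr_sum: "qr (sum f A) = (\<Sum>x\<in>A. qr (f x))"
  by (induction A rule: infinite_finite_induct) auto

text \<open>The real part behaves like a trace: a closed walk can be restarted at any of its
  vertices without changing the real part of its weight.\<close>

lemma qr_mult_commute: "qr (x * y) = qr (y * x)"
  by (simp add: quat_sel_mult)

lemma qcnj_sel [simp]:
  "qr (qcnj x) = qr x" "qi (qcnj x) = - qi x" "qj (qcnj x) = - qj x" "qk (qcnj x) = - qk x"
  by (simp_all add: qcnj_def)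

lemma qcnj_simps [simp]:
  "qcnj 0 = 0" "qcnj 1 = 1" "qcnj (x + y) = qcnj x + qcnj y" "qcnj (x - y) = qcnj x - qcnj y"
  "qcnj (- x) = - qcnj x" "qcnj (c *\<^sub>R x) = c *\<^sub>R qcnj x" "qcnj (qcnj x) = x"
  by (auto intro!: quat_eqI)

lemma qcnj_mult: "qcnj (x * y) = qcnj y * qcnj x"
  by (auto intro!: quat_eqI simp: quat_sel_mult)

lemma qcnj_sum: "qcnj (sum f A) = (\<Sum>x\<in>A. qcnj (f x))"
  by (induction A rule: infinite_finite_induct) auto

lemma qcnj_fixed_imp_real: "qcnj x = x \<Longrightarrow> x = of_real (qr x)"
  by (cases x) (auto simp: qcnj_def of_real_def scaleR_quat_def)

lemma qr_qcnj_mult_self: "qr (qcnj x * x) = (qr x)\<^sup>2 + (qi x)\<^sup>2 + (qj x)\<^sup>2 + (qk x)\<^sup>2"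
  by (simp add: quat_sel_mult power2_eq_square)

lemma qr_qcnj_mult_self_nonneg: "0 \<le> qr (qcnj x * x)"
  by (simp add: qr_qcnj_mult_self)

lemma qr_qcnj_mult_self_eq_0_iff: "qr (qcnj x * x) = 0 \<longleftrightarrow> x = 0"
proof
  assume "qr (qcnj x * x) = 0"
  then have "(qr x)\<^sup>2 + (qi x)\<^sup>2 + (qj x)\<^sup>2 + (qk x)\<^sup>2 = 0"
    by (simp add: qr_qcnj_mult_self)
  then have "(qr x)\<^sup>2 = 0" "(qi x)\<^sup>2 = 0" "(qj x)\<^sup>2 = 0" "(qk x)\<^sup>2 = 0"
    by (smt (verit) zero_le_power2)+
  then show "x = 0" by (auto intro!: quat_eqI)
qed auto

lemma divide_of_real_quat: "(x::quat) / of_real d = (1 / d) *\<^sub>R x"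
  \<comment> \<open>For \<open>d = 0\<close> both sides are 0, because real division by 0 gives 0 in
    every component.\<close>
  by (cases "d = 0") (auto intro!: quat_eqI simp: divide_quat_def inverse_quat_def quat_sel_mult
      of_real_def Let_def power2_eq_square)

section \<open>Path expansion of column determinants\<close>

text \<open>The start \<open>i\<close> is left out of the list, so \<open>length q\<close> counts
  the edges of the path, and the cycle that closes up \<open>i # q\<close> has sign
  \<open>(- 1) ^ length q\<close>.\<close>

definition paths :: "nat set \<Rightarrow> nat \<Rightarrow> nat list set" where
  "paths S i = {q. distinct (i # q) \<and> set q \<subseteq> S}"

fun walk :: "qmat \<Rightarrow> nat list \<Rightarrow> quat" where
  "walk a (x # y # zs) = a x y * walk a (y # zs)"
| "walk a xs = 1"

lemma walk_append: "walk a (xs @ y # zs) = walk a (xs @ [y]) * walk a (y # zs)"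
proof (induction xs)
  case (Cons x xs)
  then show ?case by (cases xs) (auto simp: mult.assoc)
qed auto

lemma walk_conv_prod_list:
  "walk a xs = prod_list (map (\<lambda>s. a (xs ! s) (xs ! Suc s)) [0..<length xs - 1])"
proof (induction xs rule: induct_list012)
  case (3 x y zs)
  have "[0..<length (x # y # zs) - 1] = 0 # map Suc [0..<length (y # zs) - 1]"
    by (simp add: upt_conv_Cons map_Suc_upt del: upt_Suc)
  then show ?case using 3(2) by (simp add: comp_def del: upt_Suc)
qed auto

definition heads :: "nat set \<Rightarrow> (nat \<Rightarrow> nat) \<Rightarrow> nat set" where
  "heads S \<tau> = {x \<in> S. x = Min (orb \<tau> x)}"

text \<open>The term of \<tau> with no column singled out: all cycles are treated alike, each
  starting at its minimum. This form also covers the empty set, so it applies to the complement of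
  any cycle.\<close>

definition heads_term :: "qmat \<Rightarrow> nat set \<Rightarrow> (nat \<Rightarrow> nat) \<Rightarrow> quat" where
  "heads_term a S \<tau> = (- 1) ^ (card S - card (heads S \<tau>)) *
     prod_list (map (cyc_prod a \<tau>) (rev (sorted_list_of_set (heads S \<tau>))))"

section \<open>Orbits and cycles of a permutation\<close>

lemma orb_self: "x \<in> orb \<tau> x"
  unfolding orb_def by (auto intro: exI[of _ 0])

lemma orb_subset:
  assumes "\<tau> permutes S" "x \<in> S"
  shows "orb \<tau> x \<subseteq> S"
  unfolding orb_def using permutes_in_image[OF permutes_funpow[OF assms(1)]] assms(2) by auto

lemma cyc_len_conv_least_power: "cyc_len \<tau> x = least_power \<tau> x"
  unfolding cyc_len_def least_power_def by (simp add: conj_commute)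

lemma set_support_conv_orb: "permutation \<tau> \<Longrightarrow> set (support \<tau> x) = orb \<tau> x"
  by (subst support_set) (auto simp: orb_def)

lemma orb_sym:
  assumes "permutation \<tau>" "x \<in> orb \<tau> j"
  shows "j \<in> orb \<tau> x"
proof (rule ccontr)
  assume "j \<notin> orb \<tau> x"
  then have "orb \<tau> j \<inter> orb \<tau> x = {}"
    using disjoint_support'[OF assms(1), of j x] unfolding set_support_conv_orb[OF assms(1)] by blast
  then show False using assms(2) orb_self[of x \<tau>] by auto
qed

text \<open>For \<open>j = Min S\<close> the cycle through \<open>j\<close> starts at its own
  minimum, and \<open>j\<close> is the least head, hence last in decreasing order. The cycle that
  \<open>cdet\<close> forces to the right end is therefore already there in the uniform
  ordering.\<close>

lemma hdet_conv_heads_term: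
  assumes "finite S"
  shows "hdet S a = (\<Sum>\<tau> | \<tau> permutes S. heads_term a S \<tau>)"
proof (cases "S = {}")
  case True
  then show ?thesis by (simp add: hdet_def heads_term_def heads_def)
next
  case False
  define j where "j = Min S"
  have j: "j \<in> S" using False assms by (simp add: j_def)
  have "cdet S a j = (\<Sum>\<tau> | \<tau> permutes S. heads_term a S \<tau>)"
    unfolding cdet_def
  proof (rule sum.cong[OF refl])
    fix \<tau> assume "\<tau> \<in> {\<tau>. \<tau> permutes S}"
    then have t: "\<tau> permutes S" by simp
    then have pt: "permutation \<tau>" using assms permutation_permutes by blast
    have fin: "finite (orb \<tau> x)" if "x \<in> S" for x
      using orb_subset[OF t that] assms finite_subset by blast
    have heads: "heads S \<tau> = insert j (other_heads S \<tau> j)"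
    proof (intro equalityI subsetI)
      fix x assume x: "x \<in> heads S \<tau>"
      show "x \<in> insert j (other_heads S \<tau> j)"
      proof (cases "x \<in> orb \<tau> j")
        case True
        have "x \<le> j" using x orb_sym[OF pt True] fin[of x] Min_le[of "orb \<tau> x" j]
          by (auto simp: heads_def)
        moreover have "j \<le> x" using x assms by (auto simp: heads_def j_def)
        ultimately show ?thesis by simp
      qed (use x in \<open>auto simp: heads_def other_heads_def\<close>)
    next
      fix x assume x: "x \<in> insert j (other_heads S \<tau> j)"
      have "Min (orb \<tau> j) = j"
        using orb_subset[OF t j] assms orb_self[of j \<tau>] fin[OF j]
        by (intro Min_eqI) (auto simp: j_def)
      then show "x \<in> heads S \<tau>"
        using x j by (auto simp: heads_def other_heads_def)
    qed
    have fo: "finite (other_heads S \<tau> j)" using assms by (simp add: other_heads_def)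
    have nj: "j \<notin> other_heads S \<tau> j" by (simp add: other_heads_def orb_self)
    have "sorted_list_of_set (insert j (other_heads S \<tau> j))
        = j # sorted_list_of_set (other_heads S \<tau> j)"
    proof -
      have "\<forall>x\<in>other_heads S \<tau> j. j \<le> x" using assms by (auto simp: other_heads_def j_def)
      then show ?thesis using fo nj by (simp add: insort_is_Cons)
    qed
    then show "(- 1) ^ (card S - (card (other_heads S \<tau> j) + 1)) *
      (prod_list (map (cyc_prod a \<tau>) (rev (sorted_list_of_set (other_heads S \<tau> j))))
        * cyc_prod a \<tau> j) = heads_term a S \<tau>"
      unfolding heads_term_def heads using fo nj by simp
  qed
  then show ?thesis using False by (simp add: hdet_def j_def)
qed

lemma funpow_cycle_of_list_nth:
  assumes "distinct (x # xs)"
  shows "(cycle_of_list (x # xs) ^^ s) x = (x # xs) ! (s mod length (x # xs))"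
proof -
  have "map (cycle_of_list (x # xs) ^^ s) (x # xs) ! 0 = rotate s (x # xs) ! 0"
    using cyclic_rotation[OF assms] by simp
  then show ?thesis using nth_rotate[of 0 "x # xs" s] by (simp del: cycle_of_list.simps)
qed

section \<open>Gluing a cycle through \<open>j\<close> to a permutation of the remaining
  indices\<close>

context
  fixes S :: "nat set" and j :: nat and q :: "nat list" and \<tau>' \<tau> :: "nat \<Rightarrow> nat"
  assumes finS: "finite S" and jS: "j \<in> S" and q: "q \<in> paths S j"
    and \<tau>': "\<tau>' permutes S - set (j # q)"
  defines "\<tau> \<equiv> cycle_of_list (j # q) \<circ> \<tau>'"
begin

lemma glue_permutes: "\<tau> permutes S"
  unfolding \<tau>_def
proof (rule permutes_compose)
  show "\<tau>' permutes S" using \<tau>' by (rule permutes_subset) auto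
  show "cycle_of_list (j # q) permutes S"
    using cycle_permutes by (rule permutes_subset) (use q jS in \<open>auto simp: paths_def\<close>)
qed

lemma glue_outside_eq: "x \<in> S - set (j # q) \<Longrightarrow> \<tau> x = \<tau>' x"
  unfolding \<tau>_def using permutes_in_image[OF \<tau>', of x] id_outside_supp[of "\<tau>' x" "j # q"]
  by (auto simp del: cycle_of_list.simps)

lemma glue_inside_eq: "x \<in> set (j # q) \<Longrightarrow> \<tau> x = cycle_of_list (j # q) x"
  unfolding \<tau>_def using permutes_not_in[OF \<tau>', of x] by (auto simp del: cycle_of_list.simps)

lemma glue_funpow_outside: "x \<in> S - set (j # q) \<Longrightarrow> (\<tau> ^^ s) x = (\<tau>' ^^ s) x"
proof (induction s)
  case (Suc s)
  have "(\<tau>' ^^ s) x \<in> S - set (j # q)"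
    using permutes_in_image[OF permutes_funpow[OF \<tau>', of s], of x] Suc.prems by blast
  then show ?case using Suc glue_outside_eq by simp
qed auto

lemma glue_funpow_start: "(\<tau> ^^ s) j = (j # q) ! (s mod length (j # q))"
proof -
  have d: "distinct (j # q)" using q by (simp add: paths_def)
  have "(\<tau> ^^ s) j = (cycle_of_list (j # q) ^^ s) j"
  proof (induction s)
    case (Suc s)
    have "(cycle_of_list (j # q) ^^ s) j \<in> set (j # q)"
      unfolding funpow_cycle_of_list_nth[OF d] by (rule nth_mem) simp
    then show ?case using Suc glue_inside_eq by (simp del: cycle_of_list.simps)
  qed auto
  then show ?thesis using funpow_cycle_of_list_nth[OF d] by simp
qed

lemma glue_least_power: "least_power \<tau> j = length (j # q)"
  unfolding least_power_def
proof (rule Least_equality)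
  show "(\<tau> ^^ length (j # q)) j = j \<and> 0 < length (j # q)"
    unfolding glue_funpow_start by simp
next
  fix y assume y: "(\<tau> ^^ y) j = j \<and> 0 < y"
  show "length (j # q) \<le> y"
  proof (rule ccontr)
    assume "\<not> length (j # q) \<le> y"
    then have "(j # q) ! y = (j # q) ! 0" "y < length (j # q)"
      using y unfolding glue_funpow_start by auto
    then have "y = 0"
      using q nth_eq_iff_index_eq[of "j # q" y 0] by (simp add: paths_def)
    then show False using y by simp
  qed
qed

text \<open>Together with \<open>glue_restrict\<close> this inverts the gluing: the orbit of
  \<open>j\<close>, listed from \<open>j\<close>, gives back the path, and restriction to the
  complement gives back \<tau>'.\<close>

lemma glue_support: "support \<tau> j = j # q"
  by (rule nth_equalityI) (auto simp: glue_least_power glue_funpow_start simp del: upt_Suc)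

lemma glue_restrict: "(\<lambda>y. if y \<in> S - set (j # q) then \<tau> y else y) = \<tau>'"
  using glue_outside_eq permutes_not_in[OF \<tau>'] by fastforce

lemma glue_other_heads: "other_heads S \<tau> j = heads (S - set (j # q)) \<tau>'"
proof -
  have pt: "permutation \<tau>" using glue_permutes finS permutation_permutes by blast
  have o: "orb \<tau> j = set (j # q)"
    using set_support_conv_orb[OF pt, of j] glue_support by simp
  have "orb \<tau> x = orb \<tau>' x" if "x \<in> S - set (j # q)" for x
    unfolding orb_def using glue_funpow_outside[OF that] by simp
  then show ?thesis unfolding other_heads_def heads_def o by auto
qed

lemma glue_cyc_prod_outside: "x \<in> S - set (j # q) \<Longrightarrow> cyc_prod a \<tau> x = cyc_prod a \<tau>' x"
  unfolding cyc_prod_def cyc_len_def using glue_funpow_outside[of x] by (simp del: funpow.simps)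

lemma glue_cyc_prod_start: "cyc_prod a \<tau> j = walk a (j # q @ [j])"
proof -
  have n: "(\<tau> ^^ s) j = (j # q @ [j]) ! s" if "s \<le> length (j # q)" for s
  proof (cases "s = length (j # q)")
    case False
    then have "s < length (j # q)" using that by linarith
    then have "(\<tau> ^^ s) j = (j # q) ! s" unfolding glue_funpow_start by simp
    also have "\<dots> = ((j # q) @ [j]) ! s"
      using \<open>s < length (j # q)\<close> by (simp only: nth_append if_True)
    finally show ?thesis by simp
  qed (simp only: glue_funpow_start, simp add: nth_append)
  show ?thesis
    unfolding cyc_prod_def cyc_len_conv_least_power glue_least_power walk_conv_prod_list
  proof (intro arg_cong[where f = prod_list] map_cong)
    fix s assume "s \<in> set [0..<length (j # q @ [j]) - 1]"
    then have "s \<le> length (j # q)" "Suc s \<le> length (j # q)" by auto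
    then show "a ((\<tau> ^^ s) j) ((\<tau> ^^ Suc s) j) = a ((j # q @ [j]) ! s) ((j # q @ [j]) ! Suc s)"
      by (simp only: n)
  qed simp
qed

lemma glue_term:
  "(- 1) ^ (card S - (card (other_heads S \<tau> j) + 1)) *
      (prod_list (map (cyc_prod a \<tau>) (rev (sorted_list_of_set (other_heads S \<tau> j))))
        * cyc_prod a \<tau> j)
   = (- 1) ^ length q * heads_term a (S - set (j # q)) \<tau>' * walk a (j # q @ [j])"
proof -
  let ?T = "S - set (j # q)"
  have c: "card S = card ?T + Suc (length q)"
  proof -
    have d: "distinct (j # q)" "set (j # q) \<subseteq> S" using q jS by (auto simp: paths_def)
    then have "card (set (j # q)) = Suc (length q)" using distinct_card by fastforce
    then show ?thesis
      using card_Diff_subset[of "set (j # q)" S] card_mono[OF finS d(2)] d(2) finS by simp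
  qed
  \<comment> \<open>The exponents are truncated differences of naturals; this bound makes the sign
    split as a product.\<close>
  have h: "card (heads ?T \<tau>') \<le> card ?T"
    using finS by (intro card_mono) (auto simp: heads_def)
  have "map (cyc_prod a \<tau>) (rev (sorted_list_of_set (heads ?T \<tau>')))
      = map (cyc_prod a \<tau>') (rev (sorted_list_of_set (heads ?T \<tau>')))"
  proof (rule map_cong[OF refl])
    fix x assume "x \<in> set (rev (sorted_list_of_set (heads ?T \<tau>')))"
    then have "x \<in> ?T" using finS by (simp add: heads_def)
    then show "cyc_prod a \<tau> x = cyc_prod a \<tau>' x" by (rule glue_cyc_prod_outside)
  qed
  moreover have "card S - (card (heads ?T \<tau>') + 1) = length q + (card ?T - card (heads ?T \<tau>'))"
    using c h by linarith
  ultimately show ?thesis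
    unfolding glue_other_heads glue_cyc_prod_start heads_term_def
    by (simp only: power_add mult.assoc)
qed

end

lemma finite_paths: "finite S \<Longrightarrow> finite (paths S i)"
proof -
  assume S: "finite S"
  have "paths S i \<subseteq> {q. set q \<subseteq> S \<and> length q \<le> card S}"
  proof
    fix q assume q: "q \<in> paths S i"
    then have "card (set q) \<le> card S" using S by (intro card_mono) (auto simp: paths_def)
    then show "q \<in> {q. set q \<subseteq> S \<and> length q \<le> card S}"
      using q distinct_card[of q] by (auto simp: paths_def)
  qed
  then show ?thesis using finite_lists_length_le[OF S] finite_subset by blast
qed

text \<open>Every permutation of \<open>S\<close> is uniquely a cycle through \<open>j\<close>
  composed with a permutation of the complement. The cycle stands at the right end of its term, so
  for a fixed cycle the left factors sum up to \<open>hdet\<close> of the complement.\<close>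

theorem cdet_conv_paths:
  assumes finS: "finite S" and jS: "j \<in> S"
  shows "cdet S a j =
    (\<Sum>q\<in>paths S j. (- 1) ^ length q * hdet (S - set (j # q)) a * walk a (j # q @ [j]))"
proof -
  let ?D = "SIGMA q:paths S j. {\<tau>'. \<tau>' permutes S - set (j # q)}"
  have "(\<Sum>(q, \<tau>')\<in>?D. (- 1) ^ length q * heads_term a (S - set (j # q)) \<tau>'
      * walk a (j # q @ [j])) = cdet S a j"
    unfolding cdet_def
  proof (rule sum.reindex_bij_witness[where
        j = "\<lambda>(q, \<tau>'). cycle_of_list (j # q) \<circ> \<tau>'" and
        i = "\<lambda>\<tau>. (tl (support \<tau> j), \<lambda>y. if y \<in> S - set (support \<tau> j) then \<tau> y else y)"], goal_cases)
    case (1 b)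
    then obtain q \<tau>' where b: "b = (q, \<tau>')" "q \<in> paths S j" "\<tau>' permutes S - set (j # q)"
      by auto
    show ?case
      unfolding b(1) prod.case glue_support[OF finS jS b(2,3)] glue_restrict[OF finS jS b(2,3)]
      by simp
  next
    case (2 b)
    then obtain q \<tau>' where b: "b = (q, \<tau>')" "q \<in> paths S j" "\<tau>' permutes S - set (j # q)"
      by auto
    show ?case unfolding b(1) prod.case using glue_permutes[OF finS jS b(2,3)] by simp
  next
    case (3 \<tau>)
    then have t: "\<tau> permutes S" by simp
    then have pt: "permutation \<tau>" using assms permutation_permutes by blast
    have s: "j # tl (support \<tau> j) = support \<tau> j"
      using least_power_of_permutation(2)[OF pt, of j] by (simp add: upt_conv_Cons)
    have sub: "set (support \<tau> j) \<subseteq> S"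
      using orb_subset[OF t jS] set_support_conv_orb[OF pt] by simp
    show ?case
      unfolding prod.case s
    proof
      fix y
      consider "y \<in> set (support \<tau> j)" | "y \<in> S - set (support \<tau> j)" | "y \<notin> S" by blast
      then show "(cycle_of_list (support \<tau> j) \<circ>
        (\<lambda>y. if y \<in> S - set (support \<tau> j) then \<tau> y else y)) y = \<tau> y"
      proof cases
        case 1
        then show ?thesis using cycle_restrict[OF pt 1] by simp
      next
        case 2
        have "\<tau> y \<in> S - set (support \<tau> j)"
          using permutes_in_image[OF semidecomposition[OF t finS, of j], of y] 2 by simp
        then show ?thesis using id_outside_supp[of "\<tau> y" "support \<tau> j"] 2 by simp
      next
        case 3
        then have "y \<notin> set (support \<tau> j)" using sub by blast
        then show ?thesis
          using id_outside_supp[of y "support \<tau> j"] 3 permutes_not_in[OF t 3] by simp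
      qed
    qed
  next
    case (4 \<tau>)
    then have t: "\<tau> permutes S" by simp
    then have pt: "permutation \<tau>" using assms permutation_permutes by blast
    have s: "j # tl (support \<tau> j) = support \<tau> j"
      using least_power_of_permutation(2)[OF pt, of j] by (simp add: upt_conv_Cons)
    have sub: "set (support \<tau> j) \<subseteq> S"
      using orb_subset[OF t jS] set_support_conv_orb[OF pt] by simp
    have "tl (support \<tau> j) \<in> paths S j"
      unfolding paths_def using cycle_of_permutation[OF pt, of j] sub s
      by (metis (mono_tags, lifting) mem_Collect_eq set_subset_Cons subset_trans)
    then show ?case
      unfolding mem_Sigma_iff mem_Collect_eq s
      using semidecomposition[OF t finS, of j] by blast
  next
    case (5 b)
    then obtain q \<tau>' where b: "b = (q, \<tau>')" "q \<in> paths S j" "\<tau>' permutes S - set (j # q)"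
      by auto
    show ?case unfolding b(1) prod.case by (rule glue_term[OF finS jS b(2,3)])
  qed
  then have "cdet S a j = (\<Sum>q\<in>paths S j. \<Sum>\<tau>' | \<tau>' permutes S - set (j # q).
      (- 1) ^ length q * heads_term a (S - set (j # q)) \<tau>' * walk a (j # q @ [j]))"
    using finS by (subst sum.Sigma) (auto intro: finite_permutations simp: finite_paths)
  also have "\<dots> = (\<Sum>q\<in>paths S j.
      (- 1) ^ length q * hdet (S - set (j # q)) a * walk a (j # q @ [j]))"
    using finS by (intro sum.cong) (auto simp: hdet_conv_heads_term sum_distrib_left sum_distrib_right)
  finally show ?thesis .
qed

lemma walk_snoc: "walk a (x # xs @ [y]) = walk a (x # xs) * a (last (x # xs)) y"
proof (induction xs arbitrary: x)
  case (Cons z zs)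
  then show ?case by (simp add: mult.assoc)
qed simp

text \<open>A walk reads only the columns of vertices that it enters, so the column of the start
  matters only if the walk returns there.\<close>

lemma walk_cong: "(\<And>x y. y \<in> set (tl xs) \<Longrightarrow> a x y = b x y) \<Longrightarrow> walk a xs = walk b xs"
  by (induction xs rule: induct_list012) auto

lemma hdet_cong:
  assumes "finite S" "\<And>x y. x \<in> S \<Longrightarrow> y \<in> S \<Longrightarrow> a x y = b x y"
  shows "hdet S a = hdet S b"
proof -
  have "cyc_prod a \<tau> x = cyc_prod b \<tau> x" if "\<tau> permutes S" "x \<in> S" for \<tau> x
  proof -
    have "(\<tau> ^^ s) x \<in> S" for s
      using permutes_in_image[OF permutes_funpow[OF that(1)]] that(2) by blast
    then have "a ((\<tau> ^^ s) x) ((\<tau> ^^ Suc s) x) = b ((\<tau> ^^ s) x) ((\<tau> ^^ Suc s) x)" for s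
      using assms(2) by blast
    then show ?thesis unfolding cyc_prod_def by presburger
  qed
  then have "heads_term a S \<tau> = heads_term b S \<tau>" if "\<tau> permutes S" for \<tau>
    unfolding heads_term_def using that assms(1)
    by (intro arg_cong2[where f = times] arg_cong[where f = prod_list] map_cong refl)
      (simp add: heads_def)
  then show ?thesis using assms(1) by (simp add: hdet_conv_heads_term)
qed

text \<open>Column \<open>i\<close> is read by a single edge, the one that closes the cycle at
  \<open>i\<close>; neither the path before it nor the complementary minor sees the
  replacement.\<close>

lemma cdet_colrep_conv_paths:
  assumes "finite S" "i \<in> S"
  shows "cdet S (colrep a i b) i = (\<Sum>q\<in>paths S i.
    (- 1) ^ length q * hdet (S - set (i # q)) a * (walk a (i # q) * b (last (i # q))))"
  unfolding cdet_conv_paths[OF assms]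
proof (intro sum.cong refl arg_cong2[where f = times])
  fix q assume q: "q \<in> paths S i"
  show "hdet (S - set (i # q)) (colrep a i b) = hdet (S - set (i # q)) a"
    using assms by (intro hdet_cong) (auto simp: colrep_def)
  have "walk (colrep a i b) (i # q) = walk a (i # q)"
    using q by (intro walk_cong) (auto simp: colrep_def paths_def)
  then show "walk (colrep a i b) (i # q @ [i]) = walk a (i # q) * b (last (i # q))"
    by (simp only: walk_snoc) (simp add: colrep_def)
qed

section \<open>Determinants of Hermitian matrices\<close>

definition qhermitian :: "qmat \<Rightarrow> bool" where
  "qhermitian a \<longleftrightarrow> (\<forall>i j. a j i = qcnj (a i j))"

lemma walk_rev:
  assumes "qhermitian a"
  shows "walk a (rev xs) = qcnj (walk a xs)"
proof (induction xs rule: induct_list012)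
  case (3 x y zs)
  have "walk a (rev (x # y # zs)) = walk a (rev zs @ y # [x])" by simp
  also have "\<dots> = walk a (rev (y # zs)) * a y x"
    by (subst walk_append) simp
  also have "a y x = qcnj (a x y)" using assms unfolding qhermitian_def by blast
  finally show ?case using 3(2) by (simp add: qcnj_mult)
qed auto

text \<open>A simple path from \<open>i\<close> through \<open>k\<close>, cut at \<open>k\<close>.
  The same pairs index two disjoint cycles, one through \<open>i\<close> and one through
  \<open>k\<close>, and the condition is symmetric under exchanging \<open>i\<close>,
  \<open>u\<close> with \<open>k\<close>, \<open>v\<close>.\<close>

definition path_pairs :: "nat set \<Rightarrow> nat \<Rightarrow> nat \<Rightarrow> (nat list \<times> nat list) set" where
  "path_pairs S i k = {(u, v). distinct (i # u @ k # v) \<and> set u \<union> set v \<subseteq> S}"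

lemma path_pairs_conv_Sigma:
  "i \<noteq> k \<Longrightarrow> path_pairs S i k = (SIGMA u:paths (S - {k}) i. paths (S - set (i # u)) k)"
  by (auto simp: path_pairs_def paths_def)

lemma sum_path_pairs_nested:
  assumes "finite S" "i \<noteq> k"
  shows "(\<Sum>u\<in>paths (S - {k}) i. \<Sum>v\<in>paths (S - set (i # u)) k. F u v)
    = (\<Sum>(u, v)\<in>path_pairs S i k. F u v)"
  unfolding path_pairs_conv_Sigma[OF assms(2)]
  by (rule sum.Sigma) (simp_all add: finite_paths assms)

lemma sum_path_pairs_swap:
  "(\<Sum>(u, v)\<in>path_pairs S i k. F u v) = (\<Sum>(u, v)\<in>path_pairs S k i. F v u)"
  by (rule sum.reindex_bij_witness[where i = "\<lambda>(u, v). (v, u)" and j = "\<lambda>(u, v). (v, u)"])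
    (auto simp: path_pairs_def)

lemma sum_paths_split:
  fixes F :: "nat list \<Rightarrow> 'b :: comm_monoid_add"
  assumes "finite S" "k \<in> S" "i \<noteq> k"
  shows "(\<Sum>q\<in>paths S i. F q)
    = (\<Sum>q\<in>paths (S - {k}) i. F q) + (\<Sum>(u, v)\<in>path_pairs S i k. F (u @ k # v))"
proof -
  have eq: "paths S i = paths (S - {k}) i \<union> {q \<in> paths S i. k \<in> set q}"
    by (auto simp: paths_def)
  have "(\<Sum>q\<in>paths S i. F q)
      = (\<Sum>q\<in>paths (S - {k}) i. F q) + (\<Sum>q | q \<in> paths S i \<and> k \<in> set q. F q)"
    using finite_paths[of S i] finite_paths[of "S - {k}" i] assms(1)
    by (subst eq, subst sum.union_disjoint) (auto simp: paths_def intro: rev_finite_subset)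
  also have "(\<Sum>q | q \<in> paths S i \<and> k \<in> set q. F q)
      = (\<Sum>p\<in>path_pairs S i k. F (fst p @ k # snd p))"
  proof (rule sum.reindex_bij_betw[symmetric], unfold bij_betw_def, intro conjI)
    show "inj_on (\<lambda>p. fst p @ k # snd p) (path_pairs S i k)"
      by (rule inj_onI) (auto simp: path_pairs_def append_Cons_eq_iff)
    show "(\<lambda>p. fst p @ k # snd p) ` path_pairs S i k = {q. q \<in> paths S i \<and> k \<in> set q}"
    proof (intro equalityI subsetI)
      fix q assume q: "q \<in> {q. q \<in> paths S i \<and> k \<in> set q}"
      then obtain u v where "q = u @ k # v" using split_list by fast
      then show "q \<in> (\<lambda>p. fst p @ k # snd p) ` path_pairs S i k"
        using q by (intro image_eqI[of _ _ "(u, v)"]) (auto simp: path_pairs_def paths_def)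
    qed (use assms in \<open>auto simp: path_pairs_def paths_def\<close>)
  qed
  finally show ?thesis by (simp add: case_prod_unfold)
qed

definition hdr :: "nat set \<Rightarrow> qmat \<Rightarrow> real" where
  "hdr S a = qr (hdet S a)"

lemma minus_one_power_mult_of_real_quat:
  "(- 1) ^ n * of_real c * (x :: quat) = ((- 1) ^ n * c) *\<^sub>R x"
  by (metis of_real_1 of_real_minus of_real_mult of_real_power scaleR_conv_of_real)

text \<open>Reversing a cycle conjugates its weight and keeps its vertex set, so the expansion is
  fixed by conjugation. To compare columns \<open>i\<close> and \<open>k\<close>, the cycles through
  \<open>i\<close> are split by whether they meet \<open>k\<close>; for those that avoid
  \<open>k\<close>, the complementary minor is expanded at \<open>k\<close> by the induction
  hypothesis.\<close>

lemma hermitian_hdet_step: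
  fixes a :: qmat
  assumes herm: "qhermitian a" and fin: "finite S" and i: "i \<in> S"
    and IH: "\<And>T. T \<subset> S \<Longrightarrow> hdet T a = of_real (hdr T a)"
      "\<And>T j. T \<subset> S \<Longrightarrow> j \<in> T \<Longrightarrow> cdet T a j = hdet T a"
  shows "cdet S a i = of_real (qr (cdet S a i))"
    and "k \<in> S \<Longrightarrow> cdet S a i = cdet S a k"
proof -
  define f where "f i q = qr (walk a (i # q @ [i]))" for i q
  have E: "cdet T a i = (\<Sum>q\<in>paths T i. ((- 1) ^ length q * hdr (T - set (i # q)) a) *\<^sub>R
      walk a (i # q @ [i]))" if "T \<subseteq> S" "i \<in> T" for T i
  proof -
    have "T - set (i # q) \<subset> S" for q using that by auto
    then show ?thesis
      using that fin finite_subset[of T S]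
      by (simp add: cdet_conv_paths IH(1) minus_one_power_mult_of_real_quat)
  qed
  have real: "cdet S a i = of_real (qr (cdet S a i))" if "i \<in> S" for i
  proof (rule qcnj_fixed_imp_real)
    have "qcnj (cdet S a i) = (\<Sum>q\<in>paths S i. ((- 1) ^ length q * hdr (S - set (i # q)) a) *\<^sub>R
        walk a (i # rev q @ [i]))"
    proof -
      have "qcnj (walk a (i # q @ [i])) = walk a (i # rev q @ [i])" for q
        using walk_rev[OF herm, of "i # q @ [i]"] by simp
      then show ?thesis using that by (simp add: E qcnj_sum)
    qed
    also have "\<dots> = cdet S a i"
      unfolding E[OF subset_refl that]
      by (rule sum.reindex_bij_witness[where i = rev and j = rev]) (auto simp: paths_def)
    finally show "qcnj (cdet S a i) = cdet S a i" .
  qed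
  show "cdet S a i = of_real (qr (cdet S a i))" using real i .
  \<comment> \<open>Two disjoint cycles through \<open>i\<close> and \<open>k\<close> are weighed
    against the single cycle that joins them. Joining makes the path one longer than
    \<open>u\<close> and \<open>v\<close> together, whence the minus sign.\<close>
  define Q where "Q i k = (\<Sum>(u, v)\<in>path_pairs S i k. (- 1) ^ (length u + length v) *
    hdr (S - set (i # u @ k # v)) a * (f i u * f k v - f i (u @ k # v)))" for i k
  have Q: "qr (cdet S a i) = Q i k" if "i \<in> S" "k \<in> S" "i \<noteq> k" for i k
  proof -
    have h: "hdr (S - set (i # q)) a = (\<Sum>v\<in>paths (S - set (i # q)) k. (- 1) ^ length v *
        hdr (S - set (i # q @ k # v)) a * f k v)" if q: "q \<in> paths (S - {k}) i" for q
    proof -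
      have "S - set (i # q) \<subset> S" "k \<in> S - set (i # q)"
        using that \<open>i \<in> S\<close> \<open>k \<in> S\<close> \<open>i \<noteq> k\<close> by (auto simp: paths_def)
      then have "hdr (S - set (i # q)) a = qr (cdet (S - set (i # q)) a k)"
        unfolding hdr_def using IH(2) by simp
      moreover have "S - set (i # q) - set (k # v) = S - set (i # q @ k # v)" for v by auto
      ultimately show ?thesis
        using E[of "S - set (i # q)" k] \<open>k \<in> S - set (i # q)\<close>
        by (simp only: Diff_subset qr_sum quat_sel f_def)
    qed
    have "qr (cdet S a i) =
        (\<Sum>q\<in>paths (S - {k}) i. (- 1) ^ length q * hdr (S - set (i # q)) a * f i q)
        + (\<Sum>(u, v)\<in>path_pairs S i k. (- 1) ^ length (u @ k # v) *
            hdr (S - set (i # u @ k # v)) a * f i (u @ k # v))"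
      unfolding E[OF subset_refl that(1)] qr_sum quat_sel
      by (subst sum_paths_split[OF fin that(2,3)]) (simp only: f_def)
    also have "(\<Sum>q\<in>paths (S - {k}) i. (- 1) ^ length q * hdr (S - set (i # q)) a * f i q)
        = (\<Sum>(u, v)\<in>path_pairs S i k. (- 1) ^ (length u + length v) *
            hdr (S - set (i # u @ k # v)) a * (f i u * f k v))"
      unfolding sum_path_pairs_nested[OF fin that(3), symmetric]
      by (rule sum.cong[OF refl])
        (simp only: h sum_distrib_left sum_distrib_right power_add mult_ac)
    finally show ?thesis
      unfolding Q_def by (simp add: case_prod_unfold sum.distrib[symmetric] algebra_simps)
  qed
  have "Q i k = Q k i" for i k
  proof -
    have t: "(- 1) ^ (length v + length u) * hdr (S - set (i # v @ k # u)) a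
        * (f i v * f k u - f i (v @ k # u))
      = (- 1) ^ (length u + length v) * hdr (S - set (k # u @ i # v)) a
        * (f k u * f i v - f k (u @ i # v))" for u v
    proof -
      \<comment> \<open>The two closed walks are rotations of one cycle, started at \<open>i\<close>
        and at \<open>k\<close>.\<close>
      have "walk a (i # (v @ k # u) @ [i]) = walk a (i # v @ [k]) * walk a (k # u @ [i])"
        using walk_append[of a "i # v" k "u @ [i]"] by simp
      moreover have "walk a (k # (u @ i # v) @ [k]) = walk a (k # u @ [i]) * walk a (i # v @ [k])"
        using walk_append[of a "k # u" i "v @ [k]"] by simp
      ultimately have "f i (v @ k # u) = f k (u @ i # v)"
        unfolding f_def by (simp only: qr_mult_commute)
      moreover have "set (i # v @ k # u) = set (k # u @ i # v)" by auto
      ultimately show ?thesis by (simp only: add.commute mult.commute)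
    qed
    show ?thesis unfolding Q_def by (subst sum_path_pairs_swap) (simp only: t)
  qed
  then show "cdet S a i = cdet S a k" if "k \<in> S"
    using Q[of i k] Q[of k i] real i that by (cases "i = k") metis+
qed

lemma hermitian_hdet:
  assumes "qhermitian a" "finite S"
  shows "hdet S a = of_real (hdr S a) \<and> (\<forall>i\<in>S. cdet S a i = hdet S a)"
  using assms(2)
proof (induction S rule: finite_psubset_induct)
  case (psubset S)
  show ?case
  proof (cases "S = {}")
    case True
    then show ?thesis by (simp add: hdet_def hdr_def)
  next
    case False
    have IH: "hdet T a = of_real (hdr T a)" "j \<in> T \<Longrightarrow> cdet T a j = hdet T a"
      if "T \<subset> S" for T j using psubset.IH that by auto
    have h: "hdet S a = cdet S a (Min S)" "Min S \<in> S"
      using False psubset.hyps by (simp_all add: hdet_def)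
    show ?thesis
      unfolding hdr_def h(1)
      using hermitian_hdet_step[OF assms(1) psubset.hyps _ IH] h(2) by blast
  qed
qed

lemma hdet_hermitian: "qhermitian a \<Longrightarrow> finite S \<Longrightarrow> hdet S a = of_real (hdr S a)"
  and cdet_hermitian: "qhermitian a \<Longrightarrow> finite S \<Longrightarrow> i \<in> S \<Longrightarrow> cdet S a i = of_real (hdr S a)"
  using hermitian_hdet by auto

lemma hdr_empty [simp]: "hdr {} a = 1"
  by (simp add: hdr_def hdet_def)

section \<open>Column replacement and Cramer's rule for Hermitian matrices\<close>

lemma hermitian_cdet_colrep:
  assumes "qhermitian a" "finite S" "i \<in> S"
  shows "cdet S (colrep a i b) i = (\<Sum>q\<in>paths S i.
    ((- 1) ^ length q * hdr (S - set (i # q)) a) *\<^sub>R (walk a (i # q) * b (last (i # q))))"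
  using assms
  by (simp add: cdet_colrep_conv_paths hdet_hermitian minus_one_power_mult_of_real_quat)

lemma hermitian_cdet:
  assumes "qhermitian a" "finite S" "i \<in> S"
  shows "(\<Sum>q\<in>paths S i. ((- 1) ^ length q * hdr (S - set (i # q)) a) *\<^sub>R walk a (i # q @ [i]))
    = of_real (hdr S a)"
  using assms cdet_hermitian[OF assms]
  by (simp add: cdet_conv_paths hdet_hermitian minus_one_power_mult_of_real_quat)

text \<open>The paths from i avoiding k cancel against those running through k: the part
  behind k of the latter sums up to the column determinant at k of the complement.\<close>

lemma hermitian_cdet_repeated_column:
  assumes "qhermitian a" "finite S" "i \<in> S" "k \<in> S" "i \<noteq> k"
  shows "(\<Sum>q\<in>paths S i. ((- 1) ^ length q * hdr (S - set (i # q)) a) *\<^sub>R walk a (i # q @ [k])) = 0"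
proof -
  let ?c = "\<lambda>q. (- 1) ^ length q * hdr (S - set (i # q)) a"
  let ?d = "\<lambda>u v. (- 1) ^ (length u + length v) * hdr (S - set (i # u @ k # v)) a"
  have h: "?c q *\<^sub>R walk a (i # q @ [k])
      = (\<Sum>v\<in>paths (S - set (i # q)) k. ?d q v *\<^sub>R (walk a (i # q @ [k]) * walk a (k # v @ [k])))"
    if q: "q \<in> paths (S - {k}) i" for q
  proof -
    have "k \<in> S - set (i # q)" using that assms(4,5) by (auto simp: paths_def)
    moreover have "S - set (i # q) - set (k # v) = S - set (i # q @ k # v)" for v by auto
    ultimately have "of_real (hdr (S - set (i # q)) a) = (\<Sum>v\<in>paths (S - set (i # q)) k.
        ((- 1) ^ length v * hdr (S - set (i # q @ k # v)) a) *\<^sub>R walk a (k # v @ [k]))"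
      using hermitian_cdet[OF assms(1), of "S - set (i # q)" k] assms(2)
      by (simp only: finite_Diff)
    then have "walk a (i # q @ [k]) * of_real (hdr (S - set (i # q)) a)
        = (\<Sum>v\<in>paths (S - set (i # q)) k. ((- 1) ^ length v * hdr (S - set (i # q @ k # v)) a) *\<^sub>R
            (walk a (i # q @ [k]) * walk a (k # v @ [k])))"
      by (simp only: sum_distrib_left mult_scaleR_right)
    then have "(- 1) ^ length q *\<^sub>R (hdr (S - set (i # q)) a *\<^sub>R walk a (i # q @ [k]))
        = (- 1) ^ length q *\<^sub>R (\<Sum>v\<in>paths (S - set (i # q)) k.
            ((- 1) ^ length v * hdr (S - set (i # q @ k # v)) a) *\<^sub>R
            (walk a (i # q @ [k]) * walk a (k # v @ [k])))"
      by (simp only: of_real_def mult_scaleR_right mult_1_right)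
    then show ?thesis by (simp only: scaleR_sum_right scaleR_scaleR power_add mult.assoc)
  qed
  have w: "walk a (i # (u @ k # v) @ [k]) = walk a (i # u @ [k]) * walk a (k # v @ [k])" for u v
    using walk_append[of a "i # u" k "v @ [k]"] by simp
  have "(\<Sum>q\<in>paths S i. ?c q *\<^sub>R walk a (i # q @ [k]))
      = (\<Sum>q\<in>paths (S - {k}) i. ?c q *\<^sub>R walk a (i # q @ [k]))
      + (\<Sum>(u, v)\<in>path_pairs S i k. ?c (u @ k # v) *\<^sub>R walk a (i # (u @ k # v) @ [k]))"
    by (rule sum_paths_split[OF assms(2,4,5)])
  also have "(\<Sum>q\<in>paths (S - {k}) i. ?c q *\<^sub>R walk a (i # q @ [k]))
      = (\<Sum>(u, v)\<in>path_pairs S i k. ?d u v *\<^sub>R (walk a (i # u @ [k]) * walk a (k # v @ [k])))"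
    unfolding sum_path_pairs_nested[OF assms(2,5), symmetric]
    by (intro sum.cong refl) (simp only: h)
  finally show ?thesis
    unfolding w by (simp add: case_prod_unfold sum.distrib[symmetric])
qed

text \<open>The unknowns multiply from the right and so factor out of the path expansion. The
  coefficient of \<open>y k\<close> is the determinant with column \<open>k\<close> put in place
  \<open>i\<close>, which vanishes unless \<open>k = i\<close>.\<close>

lemma hermitian_cramer:
  assumes "qhermitian a" "finite S" "i \<in> S"
  shows "cdet S (colrep a i (\<lambda>l. \<Sum>k\<in>S. a l k * y k)) i = hdr S a *\<^sub>R y i"
proof -
  let ?c = "\<lambda>q. (- 1) ^ length q * hdr (S - set (i # q)) a"
  have "cdet S (colrep a i (\<lambda>l. \<Sum>k\<in>S. a l k * y k)) i
      = (\<Sum>q\<in>paths S i. \<Sum>k\<in>S. (?c q *\<^sub>R walk a (i # q @ [k])) * y k)"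
    unfolding hermitian_cdet_colrep[OF assms] walk_snoc
    by (simp only: sum_distrib_left scaleR_sum_right mult.assoc mult_scaleR_left)
  also have "\<dots> = (\<Sum>k\<in>S. (\<Sum>q\<in>paths S i. ?c q *\<^sub>R walk a (i # q @ [k])) * y k)"
    by (subst sum.swap) (simp only: sum_distrib_right)
  also have "\<dots> = (\<Sum>k\<in>S. if k = i then of_real (hdr S a) * y k else 0)"
    using hermitian_cdet[OF assms] hermitian_cdet_repeated_column[OF assms]
    by (intro sum.cong refl) auto
  also have "\<dots> = hdr S a *\<^sub>R y i"
    using assms by (simp add: scaleR_conv_of_real)
  finally show ?thesis .
qed

section \<open>Sums of principal minors\<close>

definition minor_sum :: "nat \<Rightarrow> nat \<Rightarrow> qmat \<Rightarrow> real" where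
  "minor_sum k n a = (\<Sum>\<beta>\<in>Lkn k n. hdr \<beta> a)"

definition cdet_sum :: "nat \<Rightarrow> nat \<Rightarrow> qmat \<Rightarrow> nat \<Rightarrow> (nat \<Rightarrow> quat) \<Rightarrow> quat" where
  "cdet_sum k n a i x = (\<Sum>\<beta>\<in>Jkn k n i. cdet \<beta> (colrep a i x) i)"

lemma finite_Lkn: "finite (Lkn k n)"
  by (rule finite_subset[of _ "Pow {..<n}"]) (auto simp: Lkn_def)

lemma finite_Jkn: "finite (Jkn k n i)"
  using finite_Lkn by (simp add: Jkn_def)

lemma JknD:
  assumes "\<beta> \<in> Jkn k n i"
  shows "\<beta> \<subseteq> {..<n}" "finite \<beta>" "card \<beta> = k" "i \<in> \<beta>"
  using assms finite_subset[of \<beta> "{..<n}"] by (auto simp: Jkn_def Lkn_def)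

lemma cdet_sum_conv_paths:
  assumes "qhermitian a"
  shows "cdet_sum k n a i x = (\<Sum>\<beta>\<in>Jkn k n i. \<Sum>q\<in>paths \<beta> i.
    ((- 1) ^ length q * hdr (\<beta> - set (i # q)) a) *\<^sub>R (walk a (i # q) * x (last (i # q))))"
  unfolding cdet_sum_def
  by (intro sum.cong refl hermitian_cdet_colrep assms) (auto dest: JknD)

text \<open>Expanding \<open>cdet_sum k\<close> at the column \<open>a x\<close>, the coefficient of \<open>x m\<close> for \<open>m \<in> \<beta>\<close> is given by
  Cramer's rule, while a path in \<open>\<beta>\<close> continued by one step to \<open>m \<notin> \<beta>\<close> is a path in
  \<open>insert m \<beta>\<close> of opposite sign, so that it cancels against a term of \<open>cdet_sum (Suc k)\<close>.\<close>

lemma cdet_sum_Suc: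
  assumes herm: "qhermitian a" and i: "i < n"
  shows "cdet_sum k n a i (\<lambda>l. \<Sum>m<n. a l m * x m) + cdet_sum (Suc k) n a i x
    = minor_sum k n a *\<^sub>R x i"
proof -
  define c where "c \<beta> q = (- 1) ^ length q * hdr (\<beta> - set (i # q)) a" for \<beta> q
  let ?J = "Jkn k n i" and ?J' = "Jkn (Suc k) n i"
  let ?R = "SIGMA \<beta>:?J. ({..<n} - \<beta>) \<times> paths \<beta> i"
  have "cdet_sum k n a i (\<lambda>l. \<Sum>m<n. a l m * x m)
      = (\<Sum>\<beta>\<in>?J. hdr \<beta> a *\<^sub>R x i
          + (\<Sum>m\<in>{..<n} - \<beta>. \<Sum>q\<in>paths \<beta> i. c \<beta> q *\<^sub>R (walk a (i # q @ [m]) * x m)))"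
    unfolding cdet_sum_def
  proof (intro sum.cong refl)
    fix \<beta> assume "\<beta> \<in> ?J"
    note b = JknD[OF this]
    have "(\<Sum>m<n. a l m * x m) = (\<Sum>m\<in>\<beta>. a l m * x m) + (\<Sum>m\<in>{..<n} - \<beta>. a l m * x m)" for l
      using sum.subset_diff[OF b(1), of "\<lambda>m. a l m * x m"] by (simp add: add.commute)
    then have "cdet \<beta> (colrep a i (\<lambda>l. \<Sum>m<n. a l m * x m)) i
        = cdet \<beta> (colrep a i (\<lambda>l. \<Sum>m\<in>\<beta>. a l m * x m)) i
        + cdet \<beta> (colrep a i (\<lambda>l. \<Sum>m\<in>{..<n} - \<beta>. a l m * x m)) i"
      unfolding hermitian_cdet_colrep[OF herm b(2,4)]
      by (simp only: distrib_left scaleR_add_right sum.distrib)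
    moreover have "cdet \<beta> (colrep a i (\<lambda>l. \<Sum>m\<in>{..<n} - \<beta>. a l m * x m)) i
        = (\<Sum>m\<in>{..<n} - \<beta>. \<Sum>q\<in>paths \<beta> i. c \<beta> q *\<^sub>R (walk a (i # q @ [m]) * x m))"
      unfolding hermitian_cdet_colrep[OF herm b(2,4)] walk_snoc c_def
      by (subst sum.swap) (simp only: sum_distrib_left scaleR_sum_right mult.assoc)
    ultimately show "cdet \<beta> (colrep a i (\<lambda>l. \<Sum>m<n. a l m * x m)) i = hdr \<beta> a *\<^sub>R x i
        + (\<Sum>m\<in>{..<n} - \<beta>. \<Sum>q\<in>paths \<beta> i. c \<beta> q *\<^sub>R (walk a (i # q @ [m]) * x m))"
      using hermitian_cramer[OF herm b(2,4)] by simp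
  qed
  also have "\<dots> = (\<Sum>\<beta>\<in>?J. hdr \<beta> a) *\<^sub>R x i
      + (\<Sum>(\<beta>, m, q)\<in>?R. c \<beta> q *\<^sub>R (walk a (i # q @ [m]) * x m))"
  proof -
    have "(\<Sum>\<beta>\<in>?J. \<Sum>m\<in>{..<n} - \<beta>. \<Sum>q\<in>paths \<beta> i. c \<beta> q *\<^sub>R (walk a (i # q @ [m]) * x m))
        = (\<Sum>(\<beta>, m, q)\<in>?R. c \<beta> q *\<^sub>R (walk a (i # q @ [m]) * x m))"
      unfolding sum.cartesian_product
      by (subst sum.Sigma) (auto simp: finite_Jkn finite_paths dest: JknD)
    then show ?thesis by (simp only: sum.distrib scaleR_sum_left)
  qed
  finally have 1: "cdet_sum k n a i (\<lambda>l. \<Sum>m<n. a l m * x m) = \<dots>" .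
  have "cdet_sum (Suc k) n a i x = (\<Sum>\<gamma>\<in>?J'. hdr (\<gamma> - {i}) a *\<^sub>R x i
      + (\<Sum>q\<in>paths \<gamma> i - {[]}. c \<gamma> q *\<^sub>R (walk a (i # q) * x (last (i # q)))))"
    unfolding cdet_sum_conv_paths[OF herm]
  proof (intro sum.cong refl)
    fix \<gamma> assume "\<gamma> \<in> ?J'"
    note g = JknD[OF this]
    have "[] \<in> paths \<gamma> i" by (simp add: paths_def)
    then have "(\<Sum>q\<in>paths \<gamma> i. c \<gamma> q *\<^sub>R (walk a (i # q) * x (last (i # q))))
      = c \<gamma> [] *\<^sub>R (walk a [i] * x (last [i]))
      + (\<Sum>q\<in>paths \<gamma> i - {[]}. c \<gamma> q *\<^sub>R (walk a (i # q) * x (last (i # q))))"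
      by (rule sum.remove[OF finite_paths[OF g(2)]])
    moreover have "c \<gamma> [] *\<^sub>R (walk a [i] * x (last [i])) = hdr (\<gamma> - {i}) a *\<^sub>R x i"
      by (simp add: c_def)
    ultimately show "(\<Sum>q\<in>paths \<gamma> i. ((- 1) ^ length q * hdr (\<gamma> - set (i # q)) a) *\<^sub>R
        (walk a (i # q) * x (last (i # q)))) = hdr (\<gamma> - {i}) a *\<^sub>R x i
      + (\<Sum>q\<in>paths \<gamma> i - {[]}. c \<gamma> q *\<^sub>R (walk a (i # q) * x (last (i # q))))"
      unfolding c_def by (simp only:)
  qed
  also have "\<dots> = (\<Sum>\<gamma>\<in>?J'. hdr (\<gamma> - {i}) a) *\<^sub>R x i
      + (\<Sum>(\<gamma>, q)\<in>(SIGMA \<gamma>:?J'. paths \<gamma> i - {[]}). c \<gamma> q *\<^sub>R (walk a (i # q) * x (last (i # q))))"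
    by (subst sum.Sigma[symmetric])
      (auto simp: finite_Jkn finite_paths sum.distrib scaleR_sum_left dest: JknD)
  \<comment> \<open>The empty path contributes the principal minors that omit \<open>i\<close>;
    Cramer's rule contributed those that contain \<open>i\<close>. Together they make up
    \<open>minor_sum\<close>.\<close>
  also have "(\<Sum>\<gamma>\<in>?J'. hdr (\<gamma> - {i}) a) = (\<Sum>\<beta>\<in>Lkn k n - ?J. hdr \<beta> a)"
  proof (rule sum.reindex_bij_witness[where i = "insert i" and j = "\<lambda>\<gamma>. \<gamma> - {i}"])
    fix \<beta> assume "\<beta> \<in> Lkn k n - ?J"
    then have "\<beta> \<subseteq> {..<n}" "finite \<beta>" "card \<beta> = k" "i \<notin> \<beta>"
      using finite_subset[of \<beta> "{..<n}"] by (auto simp: Lkn_def Jkn_def)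
    then show "insert i \<beta> - {i} = \<beta>" "insert i \<beta> \<in> ?J'"
      using i by (auto simp: Lkn_def Jkn_def)
  next
    fix \<gamma> assume "\<gamma> \<in> ?J'"
    note g = JknD[OF this]
    then show "insert i (\<gamma> - {i}) = \<gamma>" "\<gamma> - {i} \<in> Lkn k n - ?J"
      by (auto simp: Lkn_def Jkn_def)
  qed simp
  also have "(\<Sum>(\<gamma>, q)\<in>(SIGMA \<gamma>:?J'. paths \<gamma> i - {[]}). c \<gamma> q *\<^sub>R (walk a (i # q) * x (last (i # q))))
      = (\<Sum>(\<beta>, m, q)\<in>?R. - (c \<beta> q *\<^sub>R (walk a (i # q @ [m]) * x m)))"
  proof (rule sum.reindex_bij_witness[where
        i = "\<lambda>(\<beta>, m, q). (insert m \<beta>, q @ [m])" and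
        j = "\<lambda>(\<gamma>, q). (\<gamma> - {last q}, last q, butlast q)"], goal_cases)
    case (1 p)
    then show ?case by (auto simp: insert_absorb paths_def)
  next
    case (2 p)
    then obtain \<gamma> q where p: "p = (\<gamma>, q)" "\<gamma> \<in> ?J'" "q \<in> paths \<gamma> i" "q \<noteq> []" by auto
    then obtain u m where q: "q = u @ [m]" by (metis append_butlast_last_id)
    show ?case using JknD[OF p(2)] p(1,3) q by (auto simp: paths_def Jkn_def Lkn_def)
  next
    case (3 p)
    then show ?case by (auto simp: paths_def)
  next
    case (4 p)
    then obtain \<beta> m q where p: "p = (\<beta>, m, q)" "\<beta> \<in> ?J" "m < n" "m \<notin> \<beta>" "q \<in> paths \<beta> i" by auto
    show ?case using JknD[OF p(2)] p(1,3-5) by (auto simp: paths_def Jkn_def Lkn_def)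
  next
    case (5 p)
    then obtain \<gamma> q where p: "p = (\<gamma>, q)" "\<gamma> \<in> ?J'" "q \<in> paths \<gamma> i" "q \<noteq> []" by auto
    then obtain u m where q: "q = u @ [m]" by (metis append_butlast_last_id)
    have "\<gamma> - set (i # q) = \<gamma> - {m} - set (i # u)" using q by auto
    then have "c \<gamma> q = - c (\<gamma> - {m}) u" unfolding c_def using q by simp
    then show ?case using p(1) q by simp
  qed
  also have "\<dots> = - (\<Sum>(\<beta>, m, q)\<in>?R. c \<beta> q *\<^sub>R (walk a (i # q @ [m]) * x m))"
    by (simp only: case_prod_unfold sum_negf)
  finally have 2: "cdet_sum (Suc k) n a i x = (\<Sum>\<beta>\<in>Lkn k n - ?J. hdr \<beta> a) *\<^sub>R x i + \<dots>" .
  have "minor_sum k n a = (\<Sum>\<beta>\<in>Lkn k n - ?J. hdr \<beta> a) + (\<Sum>\<beta>\<in>?J. hdr \<beta> a)"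
    unfolding minor_sum_def by (rule sum.subset_diff) (auto simp: Jkn_def finite_Lkn)
  then show ?thesis unfolding 1 2 by (simp add: scaleR_left_distrib)
qed

section \<open>Gram matrices and rank\<close>

lemma qhermitian_gram: "qhermitian (qmult m (qadj A) A)"
  by (simp add: qhermitian_def qmult_def qadj_def qcnj_sum qcnj_mult)

lemma gram_mult_vec:
  "(\<Sum>j\<in>S. qmult m (qadj A) A l j * y j) = (\<Sum>i<m. qcnj (A i l) * (\<Sum>j\<in>S. A i j * y j))"
  unfolding qmult_def qadj_def sum_distrib_left sum_distrib_right
  by (subst sum.swap) (simp only: mult.assoc)

text \<open>The source of definiteness, both for the positivity of minors and for
  \<open>gram_cancel\<close>.\<close>

lemma gram_quadratic_form:
  "(\<Sum>l\<in>S. qcnj (y l) * (\<Sum>j\<in>S. qmult m (qadj A) A l j * y j))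
    = (\<Sum>i<m. qcnj (\<Sum>j\<in>S. A i j * y j) * (\<Sum>j\<in>S. A i j * y j))"
proof -
  have "(\<Sum>l\<in>S. qcnj (y l) * (\<Sum>i<m. qcnj (A i l) * w i))
      = (\<Sum>i<m. qcnj (\<Sum>j\<in>S. A i j * y j) * w i)" for w
    unfolding sum_distrib_left
    by (subst sum.swap) (simp only: qcnj_sum qcnj_mult sum_distrib_right mult.assoc)
  then show ?thesis unfolding gram_mult_vec .
qed

text \<open>A nontrivial relation \<open>y\<close> among the columns satisfies
  \<open>G y = 0\<close>, so Cramer's rule equates the minor times a nonzero \<open>y i\<close> with
  a determinant having a zero column.\<close>

lemma hdr_gram_dependent:
  assumes "finite S" "\<not> right_indep_cols m A S"
  shows "hdr S (qmult m (qadj A) A) = 0"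
proof -
  obtain y i where y: "\<forall>i<m. (\<Sum>j\<in>S. A i j * y j) = 0" and i: "i \<in> S" "y i \<noteq> 0"
    using assms(2) unfolding right_indep_cols_def by blast
  let ?G = "qmult m (qadj A) A"
  have "(\<Sum>j\<in>S. ?G l j * y j) = 0" for l
    unfolding gram_mult_vec using y by simp
  then have "hdr S ?G *\<^sub>R y i = cdet S (colrep ?G i (\<lambda>l. 0)) i"
    using hermitian_cramer[OF qhermitian_gram[of m A] assms(1) i(1), of y] by simp
  also have "\<dots> = 0"
    by (simp add: hermitian_cdet_colrep[OF qhermitian_gram assms(1) i(1)])
  finally show ?thesis using i(2) by simp
qed

text \<open>With \<open>z\<close> the conjugated \<open>s\<close>-th row of the adjugate, \<open>G z\<close> is \<open>hdr S G\<close> times the \<open>s\<close>-th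
  unit vector and \<open>z s\<close> is the principal minor that omits \<open>s\<close>.\<close>

lemma hdr_gram_independent:
  assumes "finite S" "right_indep_cols m A S"
  shows "hdr S (qmult m (qadj A) A) > 0"
  using assms
proof (induction S rule: finite_induct)
  case empty
  then show ?case by simp
next
  case (insert s T)
  let ?G = "qmult m (qadj A) A" and ?S = "insert s T"
  have fin: "finite ?S" and s: "s \<in> ?S" using insert.hyps by auto
  note herm = qhermitian_gram[of m A]
  have "right_indep_cols m A T"
    unfolding right_indep_cols_def
  proof (intro allI impI)
    fix y assume y: "\<forall>i<m. (\<Sum>j\<in>T. A i j * y j) = 0"
    have "(\<Sum>j\<in>?S. A i j * (if j = s then 0 else y j)) = (\<Sum>j\<in>T. A i j * y j)" for i
      using insert.hyps by (auto intro!: sum.cong)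
    then have "\<forall>j\<in>?S. (if j = s then 0 else y j) = 0"
      using insert.prems y unfolding right_indep_cols_def by presburger
    then show "\<forall>j\<in>T. y j = 0" using insert.hyps(2) by (metis insertCI)
  qed
  then have T: "hdr T ?G > 0" by (rule insert.IH)
  define B where "B k = cdet ?S (colrep ?G s (\<lambda>l. if l = k then 1 else 0)) s" for k
  have B: "cdet ?S (colrep ?G s b) s = (\<Sum>k\<in>?S. B k * b k)" for b
  proof -
    have "b (last (s # q)) = (\<Sum>k\<in>?S. (if last (s # q) = k then 1 else 0) * b k)"
      if "q \<in> paths ?S s" for q
    proof -
      have "last (s # q) \<in> ?S"
        using that last_in_set[of "s # q"] unfolding paths_def by auto
      then have "b (last (s # q)) = (\<Sum>k\<in>?S. if last (s # q) = k then b k else 0)"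
        using fin by (simp only: sum.delta' if_True)
      also have "\<dots> = (\<Sum>k\<in>?S. (if last (s # q) = k then 1 else 0) * b k)"
        by (intro sum.cong) auto
      finally show ?thesis .
    qed
    then have "cdet ?S (colrep ?G s b) s = (\<Sum>q\<in>paths ?S s. \<Sum>k\<in>?S.
        ((- 1) ^ length q * hdr (?S - set (s # q)) ?G) *\<^sub>R
        (walk ?G (s # q) * (if last (s # q) = k then 1 else 0)) * b k)"
      unfolding hermitian_cdet_colrep[OF herm fin s]
      by (intro sum.cong refl)
        (simp only: sum_distrib_left scaleR_sum_right mult.assoc mult_scaleR_left)
    then show ?thesis
      unfolding B_def hermitian_cdet_colrep[OF herm fin s]
      by (subst (asm) sum.swap) (simp only: sum_distrib_right)
  qed
  define z where "z k = qcnj (B k)" for k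
  have BG: "(\<Sum>k\<in>?S. B k * ?G k j) = (if j = s then of_real (hdr ?S ?G) else 0)" if "j \<in> ?S" for j
  proof -
    have "(\<Sum>l\<in>?S. ?G k l * (if l = j then 1 else 0)) = ?G k j" for k
      using fin that by (simp add: if_distrib[of "times _"] cong: if_cong)
    then have "(\<Sum>k\<in>?S. B k * ?G k j)
        = cdet ?S (colrep ?G s (\<lambda>k. \<Sum>l\<in>?S. ?G k l * (if l = j then 1 else 0))) s"
      by (simp only: B)
    then show ?thesis
      unfolding hermitian_cramer[OF herm fin s] by (simp add: of_real_def)
  qed
  have Gz: "(\<Sum>k\<in>?S. ?G j k * z k) = (if j = s then of_real (hdr ?S ?G) else 0)" if "j \<in> ?S" for j
  proof -
    have "?G j k = qcnj (?G k j)" for k using herm unfolding qhermitian_def by blast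
    then have "(\<Sum>k\<in>?S. ?G j k * z k) = qcnj (\<Sum>k\<in>?S. B k * ?G k j)"
      unfolding z_def by (simp only: qcnj_sum qcnj_mult)
    then show ?thesis using BG[OF that] by (simp add: of_real_def)
  qed
  \<comment> \<open>A simple path from \<open>s\<close> ends at \<open>s\<close> only if it is
    empty, so one term survives.\<close>
  have Bs: "B s = of_real (hdr T ?G)"
  proof -
    have "(\<Sum>q\<in>paths ?S s. ((- 1) ^ length q * hdr (?S - set (s # q)) ?G) *\<^sub>R
        (walk ?G (s # q) * (if last (s # q) = s then 1 else 0)))
      = (\<Sum>q\<in>{[]}. ((- 1) ^ length q * hdr (?S - set (s # q)) ?G) *\<^sub>R
        (walk ?G (s # q) * (if last (s # q) = s then 1 else 0)))"
    proof (rule sum.mono_neutral_right)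
      show "\<forall>q\<in>paths ?S s - {[]}. ((- 1) ^ length q * hdr (?S - set (s # q)) ?G) *\<^sub>R
        (walk ?G (s # q) * (if last (s # q) = s then 1 else 0)) = 0"
      proof
        fix q assume q: "q \<in> paths ?S s - {[]}"
        then have "last (s # q) \<noteq> s" by (auto simp: paths_def)
        then show "((- 1) ^ length q * hdr (?S - set (s # q)) ?G) *\<^sub>R
          (walk ?G (s # q) * (if last (s # q) = s then 1 else 0)) = 0"
          by (simp only: if_False mult_zero_right scaleR_zero_right)
      qed
    qed (use fin finite_paths in \<open>auto simp: paths_def\<close>)
    then show ?thesis
      unfolding B_def hermitian_cdet_colrep[OF herm fin s]
      using insert.hyps(2) by (simp add: of_real_def)
  qed
  \<comment> \<open>At \<open>z\<close> the quadratic form is the product of the minors of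
    \<open>T\<close> and \<open>insert s T\<close>. It also equals the squared norm of
    \<open>A z\<close>, which is positive because \<open>z s\<close> is nonzero and the columns are
    independent.\<close>
  have "(\<Sum>l\<in>?S. qcnj (z l) * (\<Sum>j\<in>?S. ?G l j * z j)) = of_real (hdr T ?G * hdr ?S ?G)"
  proof -
    have "(\<Sum>l\<in>?S. qcnj (z l) * (\<Sum>j\<in>?S. ?G l j * z j))
        = (\<Sum>l\<in>?S. if l = s then B l * of_real (hdr ?S ?G) else 0)"
    proof (intro sum.cong refl)
      fix l assume "l \<in> ?S"
      moreover have "qcnj (z l) = B l" by (simp add: z_def)
      ultimately show "qcnj (z l) * (\<Sum>j\<in>?S. ?G l j * z j)
          = (if l = s then B l * of_real (hdr ?S ?G) else 0)"
        by (simp only: Gz if_distrib[of "times _"] mult_zero_right)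
    qed
    then show ?thesis using fin s Bs by (simp only: sum.delta if_True of_real_mult)
  qed
  then have "qr (of_real (hdr T ?G * hdr ?S ?G))
      = (\<Sum>i<m. qr (qcnj (\<Sum>j\<in>?S. A i j * z j) * (\<Sum>j\<in>?S. A i j * z j)))"
    unfolding gram_quadratic_form by (simp only: qr_sum[symmetric])
  moreover have "\<dots> > 0"
  proof -
    have "z s \<noteq> 0" using Bs T by (simp add: z_def of_real_def)
    then obtain i where "i < m" "(\<Sum>j\<in>?S. A i j * z j) \<noteq> 0"
      using insert.prems s unfolding right_indep_cols_def by blast
    then show ?thesis
      using qr_qcnj_mult_self_eq_0_iff qr_qcnj_mult_self_nonneg
      by (intro sum_pos2[of _ i]) (auto simp: less_le)
  qed
  ultimately have "0 < hdr T ?G * hdr ?S ?G" by (simp add: of_real_def)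
  then show ?case using T by (simp only: zero_less_mult_pos)
qed

section \<open>Rank and the vanishing or positivity of minor sums\<close>

lemma qrank_ge:
  assumes "K \<subseteq> {..<n}" "right_indep_cols m A K"
  shows "card K \<le> qrank m n A"
  unfolding qrank_def using assms by (intro Max_ge) auto

lemma qrank_witness:
  obtains K where "K \<subseteq> {..<n}" "right_indep_cols m A K" "card K = qrank m n A"
proof -
  have "right_indep_cols m A {}" by (simp add: right_indep_cols_def)
  then have "qrank m n A \<in> {card K | K. K \<subseteq> {..<n} \<and> right_indep_cols m A K}"
    unfolding qrank_def by (intro Max_in) auto
  then show ?thesis using that by auto
qed

lemma qrank_le: "qrank m n A \<le> n"
  by (metis qrank_witness card_mono finite_lessThan card_lessThan)

lemma minor_sum_gram_eq_0:
  assumes "qrank m n A < k"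
  shows "minor_sum k n (qmult m (qadj A) A) = 0"
  unfolding minor_sum_def
proof (intro sum.neutral ballI)
  fix \<beta> assume "\<beta> \<in> Lkn k n"
  then have b: "\<beta> \<subseteq> {..<n}" "card \<beta> = k" by (auto simp: Lkn_def)
  then have "\<not> right_indep_cols m A \<beta>" using qrank_ge[OF b(1)] assms by fastforce
  then show "hdr \<beta> (qmult m (qadj A) A) = 0"
    using b(1) by (intro hdr_gram_dependent) (auto intro: finite_subset)
qed

text \<open>No minor of a Gram matrix is negative, and a largest independent set of columns
  contributes a positive one. This makes the denominators of the final formulas nonzero.\<close>

lemma minor_sum_gram_qrank_pos: "minor_sum (qrank m n A) n (qmult m (qadj A) A) > 0"
proof -
  obtain K where K: "K \<subseteq> {..<n}" "right_indep_cols m A K" "card K = qrank m n A"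
    by (rule qrank_witness)
  have "hdr \<beta> (qmult m (qadj A) A) \<ge> 0" if "\<beta> \<in> Lkn (qrank m n A) n" for \<beta>
    using that hdr_gram_dependent[of \<beta> m A] hdr_gram_independent[of \<beta> m A]
      finite_subset[of \<beta> "{..<n}"] by (cases "right_indep_cols m A \<beta>") (auto simp: Lkn_def)
  moreover have "hdr K (qmult m (qadj A) A) > 0"
    using K finite_subset[of K "{..<n}"] by (intro hdr_gram_independent) auto
  ultimately show ?thesis
    unfolding minor_sum_def using K by (intro sum_pos2[of _ K]) (auto simp: Lkn_def finite_Lkn[unfolded Lkn_def])
qed

section \<open>The Moore--Penrose inverse\<close>

definition qscale :: "real \<Rightarrow> qmat \<Rightarrow> qmat" where
  "qscale c A = (\<lambda>i j. c *\<^sub>R A i j)"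

lemma qmult_assoc: "qmult k (qmult l A B) C = qmult l A (qmult k B C)"
  unfolding qmult_def sum_distrib_left sum_distrib_right
  by (subst sum.swap) (simp only: mult.assoc)

lemma qadj_qmult: "qadj (qmult k A B) = qmult k (qadj B) (qadj A)"
  by (simp add: qadj_def qmult_def qcnj_sum qcnj_mult)

lemma qadj_qadj [simp]: "qadj (qadj A) = A"
  by (simp add: qadj_def)

lemma qmult_qscale_left: "qmult k (qscale c A) B = qscale c (qmult k A B)"
  by (simp add: qmult_def qscale_def scaleR_sum_right)

lemma qmult_qscale_right: "qmult k A (qscale c B) = qscale c (qmult k A B)"
  by (simp add: qmult_def qscale_def scaleR_sum_right)

lemma qadj_qscale: "qadj (qscale c A) = qscale c (qadj A)"
  by (simp add: qadj_def qscale_def)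

lemma qscale_qscale: "qscale c (qscale d A) = qscale (c * d) A"
  by (simp add: qscale_def)

lemma qadj_qid: "qadj qid = qid"
  by (auto simp: qadj_def qid_def intro!: ext)

lemma qadj_qdiff: "qadj (qdiff A B) = qdiff (qadj A) (qadj B)"
  by (simp add: qadj_def qdiff_def)

lemma qmult_qdiff_left: "qmult k (qdiff A B) C = qdiff (qmult k A C) (qmult k B C)"
  by (simp add: qmult_def qdiff_def left_diff_distrib sum_subtractf)

lemma qmult_qdiff_right: "qmult k A (qdiff B C) = qdiff (qmult k A B) (qmult k A C)"
  by (simp add: qmult_def qdiff_def right_diff_distrib sum_subtractf)

lemma qmat_eq_refl: "qmat_eq m n A A"
  by (simp add: qmat_eq_def)

lemma qmat_eq_sym: "qmat_eq m n A B \<Longrightarrow> qmat_eq m n B A"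
  by (simp add: qmat_eq_def)

lemma qmat_eq_trans [trans]: "qmat_eq m n A B \<Longrightarrow> qmat_eq m n B C \<Longrightarrow> qmat_eq m n A C"
  by (simp add: qmat_eq_def)

lemma qmult_cong:
  "qmat_eq m k A A' \<Longrightarrow> qmat_eq k n B B' \<Longrightarrow> qmat_eq m n (qmult k A B) (qmult k A' B')"
  by (simp add: qmat_eq_def qmult_def)

lemma qadj_cong: "qmat_eq m n A B \<Longrightarrow> qmat_eq n m (qadj A) (qadj B)"
  by (simp add: qmat_eq_def qadj_def)

lemma qdiff_cong: "qmat_eq m n A A' \<Longrightarrow> qmat_eq m n B B' \<Longrightarrow> qmat_eq m n (qdiff A B) (qdiff A' B')"
  by (simp add: qmat_eq_def qdiff_def)

lemma qscale_cong: "qmat_eq m n A B \<Longrightarrow> qmat_eq m n (qscale c A) (qscale c B)"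
  by (simp add: qmat_eq_def qscale_def)

text \<open>Equality holds on the box only: in a row \<open>i\<close> with \<open>n \<le> i\<close>
  the sum over \<open>l < n\<close> misses the diagonal entry.\<close>

lemma qmult_qid_left: "qmat_eq n q (qmult n qid A) A"
proof -
  have "(\<Sum>l<n. (if i = l then 1 else 0) * A l j) = A i j" if "i < n" for i j
    using that by (subst sum.mono_neutral_cong_right[of _ "{i}" _ "\<lambda>l. A l j"]) auto
  then show ?thesis by (simp add: qmat_eq_def qmult_def qid_def)
qed

lemma qmult_qid_right: "qmat_eq m n (qmult n A qid) A"
  using qadj_cong[OF qmult_qid_left[of n m "qadj A"]] by (simp add: qadj_qmult qadj_qid)

abbreviation qzero :: qmat where
  "qzero \<equiv> \<lambda>i j. 0"

lemma qmult_qzero_right: "qmult k A qzero = qzero"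
  by (simp add: qmult_def)

lemma qdiff_eq_0D: "qmat_eq m n (qdiff A B) qzero \<Longrightarrow> qmat_eq m n A B"
  by (simp add: qmat_eq_def qdiff_def)

text \<open>If \<open>w = A z\<close> is annihilated by the adjoint of \<open>A\<close>, then the
  squared norm of \<open>w\<close>, which is the quadratic form of the Gram matrix at
  \<open>z\<close>, is 0.\<close>

lemma gram_cancel:
  assumes "qmat_eq n q (qmult m (qadj A) (qmult n A Z)) qzero"
  shows "qmat_eq m q (qmult n A Z) qzero"
  unfolding qmat_eq_def
proof (intro allI impI)
  fix i j assume i: "i < m" and j: "j < q"
  define w where "w i = (\<Sum>l<n. A i l * Z l j)" for i
  have "(\<Sum>l<n. qcnj (Z l j) * (\<Sum>i<m. qcnj (A i l) * w i)) = 0"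
    using assms j by (simp add: qmat_eq_def qmult_def qadj_def w_def)
  then have "(\<Sum>i<m. qcnj (w i) * w i) = 0"
    unfolding w_def[of "_::nat"] gram_quadratic_form[symmetric] gram_mult_vec by simp
  then have "(\<Sum>i<m. qr (qcnj (w i) * w i)) = 0"
    by (metis qr_sum quat_sel(1))
  then have "w i = 0"
    using i by (simp only: sum_nonneg_eq_0_iff qr_qcnj_mult_self_nonneg finite_lessThan
        qr_qcnj_mult_self_eq_0_iff Ball_def lessThan_iff)
  then show "qmult n A Z i j = 0" by (simp add: qmult_def w_def)
qed

text \<open>The matrices \<open>N\<^sub>k\<close>, produced by the Faddeev-LeVerrier recursion with
  sums of principal minors as coefficients. The start \<open>qzero\<close> matches the absence of
  empty index sets containing \<open>i\<close>.\<close>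

fun faddeev :: "nat \<Rightarrow> qmat \<Rightarrow> nat \<Rightarrow> qmat" where
  "faddeev n G 0 = qzero"
| "faddeev n G (Suc k) = qdiff (qscale (minor_sum k n G) qid) (qmult n (faddeev n G k) G)"

text \<open>\<open>cdet_sum_Suc\<close> is the recursion of \<open>faddeev\<close>, read for linear
  functionals of \<open>x\<close>. The induction generalizes \<open>x\<close> because its hypothesis
  is applied to \<open>G x\<close>.\<close>

lemma cdet_sum_conv_faddeev:
  assumes "qhermitian G" "i < n"
  shows "cdet_sum k n G i x = (\<Sum>m<n. faddeev n G k i m * x m)"
proof (induction k arbitrary: x)
  case 0
  have "Jkn 0 n i = {}" using JknD[of _ 0 n i] by fastforce
  then show ?case by (simp add: cdet_sum_def)
next
  case (Suc k)
  have "(\<Sum>m<n. faddeev n G (Suc k) i m * x m)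
      = (\<Sum>m<n. (minor_sum k n G *\<^sub>R qid i m) * x m)
        - (\<Sum>m<n. (\<Sum>l<n. faddeev n G k i l * G l m) * x m)"
    by (simp add: qdiff_def qscale_def qmult_def left_diff_distrib sum_subtractf)
  also have "(\<Sum>m<n. (\<Sum>l<n. faddeev n G k i l * G l m) * x m)
      = cdet_sum k n G i (\<lambda>l. \<Sum>m<n. G l m * x m)"
    unfolding Suc.IH sum_distrib_left sum_distrib_right
    by (subst sum.swap) (simp only: mult.assoc)
  also have "(\<Sum>m<n. (minor_sum k n G *\<^sub>R qid i m) * x m) = minor_sum k n G *\<^sub>R x i"
  proof -
    have "(\<Sum>m<n. (minor_sum k n G *\<^sub>R qid i m) * x m)
        = (\<Sum>m<n. if i = m then minor_sum k n G *\<^sub>R x m else 0)"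
      by (intro sum.cong) (auto simp: qid_def)
    then show ?thesis using assms(2) by simp
  qed
  finally have "(\<Sum>m<n. faddeev n G (Suc k) i m * x m)
      = minor_sum k n G *\<^sub>R x i - cdet_sum k n G i (\<lambda>l. \<Sum>m<n. G l m * x m)" .
  moreover have "cdet_sum (Suc k) n G i x
      = minor_sum k n G *\<^sub>R x i - cdet_sum k n G i (\<lambda>l. \<Sum>m<n. G l m * x m)"
    using cdet_sum_Suc[OF assms, of k x] by (simp only: eq_diff_eq add.commute)
  ultimately show ?case by (simp only:)
qed

text \<open>This is the Cayley-Hamilton theorem for \<open>G\<close>: there are no index sets of
  size \<open>n + 1\<close>, so the functional is zero, and unit vectors test its entries.\<close>

lemma faddeev_Suc_dim:
  assumes "qhermitian G"
  shows "qmat_eq n n (faddeev n G (Suc n)) qzero"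
  unfolding qmat_eq_def
proof (intro allI impI)
  fix i j assume ij: "i < n" "j < n"
  have "Jkn (Suc n) n i = {}"
  proof (rule equals0I)
    fix \<beta> assume "\<beta> \<in> Jkn (Suc n) n i"
    note JknD[OF this]
    then show False using card_mono[of "{..<n}" \<beta>] by simp
  qed
  then have "0 = (\<Sum>m<n. faddeev n G (Suc n) i m * (if m = j then 1 else 0))"
    using cdet_sum_conv_faddeev[OF assms ij(1), of "Suc n" "\<lambda>m. if m = j then 1 else 0"]
    by (simp only: cdet_sum_def sum.empty)
  also have "\<dots> = faddeev n G (Suc n) i j"
    using ij(2) by (simp add: if_distrib[of "times _"] cong: if_cong del: faddeev.simps)
  finally show "faddeev n G (Suc n) i j = 0" by (rule sym)
qed

lemma faddeev_commute:
  "qmat_eq n n (qmult n (faddeev n G k) G) (qmult n G (faddeev n G k))"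
proof (induction k)
  case 0
  then show ?case by (simp add: qmat_eq_def qmult_def)
next
  case (Suc k)
  have "qmat_eq n n (qmult n (qmult n (faddeev n G k) G) G) (qmult n G (qmult n (faddeev n G k) G))"
    using qmult_cong[OF Suc.IH qmat_eq_refl, of n G] by (simp only: qmult_assoc)
  moreover have "qmat_eq n n (qmult n qid G) (qmult n G qid)"
    using qmult_qid_left qmult_qid_right qmat_eq_sym qmat_eq_trans by blast
  ultimately show ?case
    unfolding faddeev.simps qmult_qdiff_left qmult_qdiff_right qmult_qscale_left qmult_qscale_right
    by (intro qdiff_cong qscale_cong)
qed

text \<open>A real polynomial in a Hermitian matrix is Hermitian; commutation undoes the reversal of
  factors caused by the adjoint.\<close>

lemma faddeev_hermitian:
  assumes "qhermitian G"
  shows "qmat_eq n n (qadj (faddeev n G k)) (faddeev n G k)"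
proof (induction k)
  case 0
  then show ?case by (simp add: qmat_eq_def qadj_def)
next
  case (Suc k)
  have "qadj G = G" using assms unfolding qadj_def qhermitian_def by (intro ext) metis
  then have "qmat_eq n n (qadj (qmult n (faddeev n G k) G)) (qmult n G (faddeev n G k))"
    unfolding qadj_qmult by (simp only:) (intro qmult_cong qmat_eq_refl Suc.IH)
  also have "qmat_eq n n (qmult n G (faddeev n G k)) (qmult n (faddeev n G k) G)"
    by (rule qmat_eq_sym[OF faddeev_commute])
  finally show ?case
    unfolding faddeev.simps qadj_qdiff qadj_qscale qadj_qid by (intro qdiff_cong qmat_eq_refl)
qed

text \<open>Descent from \<open>k = n + 1\<close>. Above the rank \<open>d\<^sub>k = 0\<close>, so
  \<open>N\<^sub>k\<^sub>+\<^sub>1 = - N\<^sub>k G\<close>, and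
  \<open>G N\<^sub>k\<^sub>+\<^sub>1 = 0\<close> becomes \<open>G G N\<^sub>k = 0\<close>.
  Definiteness then removes one factor \<open>G\<close>.\<close>

lemma gram_faddeev_eq_0:
  fixes m n k :: nat and A :: qmat
  assumes "qrank m n A < k" "k \<le> Suc n"
  defines "G \<equiv> qmult m (qadj A) A"
  shows "qmat_eq n n (qmult n G (faddeev n G k)) qzero"
  using assms(2,1)
proof (induction k rule: inc_induct)
  case base
  have "qmat_eq n n (faddeev n G (Suc n)) qzero"
    unfolding G_def by (rule faddeev_Suc_dim[OF qhermitian_gram])
  from qmult_cong[OF qmat_eq_refl this] show ?case by (simp only: qmult_qzero_right)
next
  case (step k)
  let ?F = "faddeev n G k"
  have "minor_sum k n G = 0" unfolding G_def using step.prems by (rule minor_sum_gram_eq_0)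
  then have "qmult n G (faddeev n G (Suc k)) = qscale (- 1) (qmult n G (qmult n ?F G))"
    by (simp add: qscale_def qdiff_def qmult_def sum_negf)
  then have "qmat_eq n n (qscale (- 1) (qmult n G (qmult n ?F G))) qzero"
    using step.IH step.prems by (simp only: less_SucI)
  then have "qmat_eq n n (qmult n G (qmult n ?F G)) qzero"
    by (simp add: qmat_eq_def qscale_def)
  moreover have "qmat_eq n n (qmult n G (qmult n G ?F)) (qmult n G (qmult n ?F G))"
    by (intro qmult_cong qmat_eq_refl qmat_eq_sym[OF faddeev_commute])
  ultimately have "qmat_eq n n (qmult n G (qmult n G ?F)) qzero"
    by (rule qmat_eq_trans[rotated])
  then have "qmat_eq n n (qmult m (qadj A) (qmult n A (qmult m (qadj A) (qmult n A ?F)))) qzero"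
    by (simp only: G_def qmult_assoc)
  from gram_cancel[OF this]
  \<comment> \<open>The second cancellation concerns the adjoint of \<open>A\<close>; its Gram
    matrix is \<open>A\<close> times that adjoint, hence the double \<open>qadj\<close>.\<close>
  have "qmat_eq m n (qmult n (qadj (qadj A)) (qmult m (qadj A) (qmult n A ?F))) qzero"
    by simp
  from gram_cancel[OF this] show ?case by (simp only: G_def qmult_assoc)
qed

text \<open>At \<open>k = r + 1\<close> one more cancellation gives
  \<open>A N\<^sub>r\<^sub>+\<^sub>1 = 0\<close>, and one unfolding of the recursion turns this into
  the first Penrose equation up to the factor \<open>d\<^sub>r\<close>.\<close>

lemma mult_faddeev_gram:
  fixes m n :: nat and A :: qmat
  defines "G \<equiv> qmult m (qadj A) A" and "r \<equiv> qrank m n A"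
  shows "qmat_eq m n (qmult n A (qmult n (faddeev n G r) G)) (qscale (minor_sum r n G) A)"
proof -
  have "qmat_eq n n (qmult n G (faddeev n G (Suc r))) qzero"
    unfolding G_def r_def using qrank_le by (intro gram_faddeev_eq_0) auto
  then have "qmat_eq n n (qmult m (qadj A) (qmult n A (faddeev n G (Suc r)))) qzero"
    by (simp only: G_def qmult_assoc)
  then have "qmat_eq m n (qmult n A (faddeev n G (Suc r))) qzero" by (rule gram_cancel)
  then have "qmat_eq m n (qscale (minor_sum r n G) (qmult n A qid))
      (qmult n A (qmult n (faddeev n G r) G))"
    unfolding faddeev.simps qmult_qdiff_right qmult_qscale_right by (rule qdiff_eq_0D)
  from qmat_eq_trans[OF qmat_eq_sym[OF this] qscale_cong[OF qmult_qid_right]] show ?thesis .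
qed

text \<open>The first Penrose equation is \<open>mult_faddeev_gram\<close>, and its adjoint yields
  the second. The two symmetry conditions hold because \<open>N\<^sub>r\<close> is Hermitian and
  commutes with \<open>G\<close>.\<close>

lemma is_MP_faddeev:
  fixes m n :: nat and A :: qmat
  defines "G \<equiv> qmult m (qadj A) A" and "r \<equiv> qrank m n A"
  shows "is_MP m n A (qscale (1 / minor_sum r n G) (qmult n (faddeev n G r) (qadj A)))"
proof -
  let ?F = "faddeev n G r" and ?d = "minor_sum r n G"
  have d: "?d \<noteq> 0" unfolding G_def r_def using minor_sum_gram_qrank_pos[of m n A] by simp
  have AFG: "qmat_eq m n (qmult n A (qmult n ?F G)) (qscale ?d A)"
    unfolding G_def r_def by (rule mult_faddeev_gram)
  have F: "qmat_eq n n (qadj ?F) ?F"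
    unfolding G_def by (intro faddeev_hermitian qhermitian_gram)
  have G: "qadj G = G" by (simp add: G_def qadj_qmult)
  have "qmat_eq n m (qmult n G (qmult n ?F (qadj A))) (qmult n G (qmult n (qadj ?F) (qadj A)))"
    by (intro qmult_cong qmat_eq_refl qmat_eq_sym[OF F])
  also have "qmult n G (qmult n (qadj ?F) (qadj A)) = qadj (qmult n A (qmult n ?F G))"
    by (simp only: qadj_qmult G qmult_assoc)
  also have "qmat_eq n m \<dots> (qscale ?d (qadj A))"
    using qadj_cong[OF AFG] by (simp only: qadj_qscale)
  finally have GFA: "qmat_eq n m (qmult n G (qmult n ?F (qadj A))) (qscale ?d (qadj A))" .
  have 1: "qmat_eq m n (qscale (1 / ?d) (qmult n A (qmult n ?F G))) A"
    using AFG d by (simp add: qmat_eq_def qscale_def)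
  have 2: "qmat_eq n m (qscale (1 / ?d * (1 / ?d)) (qmult n ?F (qmult n G (qmult n ?F (qadj A)))))
      (qscale (1 / ?d) (qmult n ?F (qadj A)))"
  proof -
    have "qmat_eq n m (qmult n ?F (qmult n G (qmult n ?F (qadj A)))) (qscale ?d (qmult n ?F (qadj A)))"
      using qmult_cong[OF qmat_eq_refl GFA, of n ?F] by (simp only: qmult_qscale_right)
    then show ?thesis using d by (simp add: qmat_eq_def qscale_def)
  qed
  have 3: "qmat_eq m m (qmult n A (qmult n (qadj ?F) (qadj A))) (qmult n A (qmult n ?F (qadj A)))"
    by (intro qmult_cong qmat_eq_refl F)
  have 4: "qmat_eq n n (qmult n G (qadj ?F)) (qmult n ?F G)"
    using qmult_cong[OF qmat_eq_refl F, of n G] qmat_eq_sym[OF faddeev_commute] qmat_eq_trans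
    by blast
  show ?thesis
    using 1 2 qscale_cong[OF 3, of "1 / ?d"] qscale_cong[OF 4, of "1 / ?d"]
    unfolding is_MP_def qmult_qscale_left qmult_qscale_right qadj_qscale qadj_qmult qadj_qadj
      qscale_qscale qmult_assoc G_def
    by (simp only:)
qed

text \<open>\<open>A X\<close> and \<open>A Y\<close> are Hermitian and each absorbs the other, so
  taking adjoints shows them equal; likewise \<open>X A\<close> and \<open>Y A\<close>. Then
  \<open>X = X A X = Y A X = Y A Y = Y\<close>.\<close>

lemma is_MP_unique:
  assumes X: "is_MP m n A X" and Y: "is_MP m n A Y"
  shows "qmat_eq n m X Y"
proof -
  note X = X[unfolded is_MP_def] and Y = Y[unfolded is_MP_def]
  let ?P = "qmult n A X" and ?Q = "qmult n A Y"
  let ?P' = "qmult m X A" and ?Q' = "qmult m Y A"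
  have QP: "qmat_eq m m (qmult m ?Q ?P) ?P"
    using qmult_cong[of m n "qmult m ?Q A" A m X X] Y by (simp only: qmult_assoc qmat_eq_refl)
  have PQ: "qmat_eq m m (qmult m ?P ?Q) ?Q"
    using qmult_cong[of m n "qmult m ?P A" A m Y Y] X by (simp only: qmult_assoc qmat_eq_refl)
  have "qmat_eq m m ?P (qadj ?P)" using X qmat_eq_sym by blast
  also have "qmat_eq m m \<dots> (qadj (qmult m ?Q ?P))" by (rule qadj_cong[OF qmat_eq_sym[OF QP]])
  also have "qmat_eq m m \<dots> (qmult m ?P ?Q)"
    unfolding qadj_qmult[of m ?Q ?P] using X Y by (intro qmult_cong) blast+
  also note PQ
  finally have PeqQ: "qmat_eq m m ?P ?Q" .
  have QP': "qmat_eq n n (qmult n ?Q' ?P') ?Q'"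
    using qmult_cong[of n m Y Y n "qmult m ?P A" A] X by (simp only: qmult_assoc qmat_eq_refl)
  have PQ': "qmat_eq n n (qmult n ?P' ?Q') ?P'"
    using qmult_cong[of n m X X n "qmult m ?Q A" A] Y by (simp only: qmult_assoc qmat_eq_refl)
  have "qmat_eq n n ?P' (qadj ?P')" using X qmat_eq_sym by blast
  also have "qmat_eq n n \<dots> (qadj (qmult n ?P' ?Q'))" by (rule qadj_cong[OF qmat_eq_sym[OF PQ']])
  also have "qmat_eq n n \<dots> (qmult n ?Q' ?P')"
    unfolding qadj_qmult[of n ?P' ?Q'] using X Y by (intro qmult_cong) blast+
  also note QP'
  finally have PeqQ': "qmat_eq n n ?P' ?Q'" .
  have "qmat_eq n m X (qmult n ?P' X)" using X qmat_eq_sym by blast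
  also have "qmat_eq n m \<dots> (qmult n ?Q' X)" by (intro qmult_cong PeqQ' qmat_eq_refl)
  also have "qmult n ?Q' X = qmult m Y ?P" by (simp only: qmult_assoc)
  also have "qmat_eq n m \<dots> (qmult m Y ?Q)" by (intro qmult_cong PeqQ qmat_eq_refl)
  also have "qmult m Y ?Q = qmult n ?Q' Y" by (simp only: qmult_assoc)
  also have "qmat_eq n m \<dots> Y" using Y by blast
  finally show ?thesis .
qed

lemma is_MP_cong:
  assumes X: "is_MP m n A X" and eq: "qmat_eq n m X Y"
  shows "is_MP m n A Y"
proof -
  have AX: "qmat_eq m m (qmult n A Y) (qmult n A X)" and XA: "qmat_eq n n (qmult m Y A) (qmult m X A)"
    using eq by (auto intro!: qmult_cong qmat_eq_refl intro: qmat_eq_sym)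
  have "qmat_eq m n (qmult m (qmult n A Y) A) A"
    using qmult_cong[OF AX qmat_eq_refl] X unfolding is_MP_def by (blast intro: qmat_eq_trans)
  moreover have "qmat_eq n m (qmult n (qmult m Y A) Y) Y"
    using qmult_cong[OF XA qmat_eq_sym[OF eq]] X eq unfolding is_MP_def
    by (blast intro: qmat_eq_trans)
  moreover have "qmat_eq m m (qadj (qmult n A Y)) (qmult n A Y)"
    using qadj_cong[OF AX] X qmat_eq_sym[OF AX] unfolding is_MP_def by (blast intro: qmat_eq_trans)
  moreover have "qmat_eq n n (qadj (qmult m Y A)) (qmult m Y A)"
    using qadj_cong[OF XA] X qmat_eq_sym[OF XA] unfolding is_MP_def by (blast intro: qmat_eq_trans)
  ultimately show ?thesis unfolding is_MP_def by blast
qed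

lemma qMP_eqI:
  assumes X: "is_MP m n A X"
  shows "qmat_eq n m (qMP m n A) X"
proof -
  \<comment> \<open>\<open>qMP\<close> is singled out by vanishing outside its box, so
    \<open>X\<close> is truncated before the two are compared.\<close>
  define X' where "X' = (\<lambda>i j. if i < n \<and> j < m then X i j else 0)"
  have eq: "qmat_eq n m X X'" by (simp add: qmat_eq_def X'_def)
  have "qMP m n A = X'"
    unfolding qMP_def
  proof (rule the_equality)
    show "is_MP m n A X' \<and> (\<forall>i j. n \<le> i \<or> m \<le> j \<longrightarrow> X' i j = 0)"
      using is_MP_cong[OF X eq] by (auto simp: X'_def)
  next
    fix Y assume Y: "is_MP m n A Y \<and> (\<forall>i j. n \<le> i \<or> m \<le> j \<longrightarrow> Y i j = 0)"
    then have "qmat_eq n m Y X" using is_MP_unique X by blast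
    then show "Y = X'" using Y by (intro ext) (auto simp: X'_def qmat_eq_def not_less)
  qed
  then show ?thesis using qmat_eq_sym[OF eq] by simp
qed

section \<open>Determinantal representation of the inverse and of the solution\<close>

lemma sum_hdet_gram:
  "(\<Sum>\<beta>\<in>Lkn r n. hdet \<beta> (qmult m (qadj A) A)) = of_real (minor_sum r n (qmult m (qadj A) A))"
proof -
  have "hdet \<beta> (qmult m (qadj A) A) = of_real (hdr \<beta> (qmult m (qadj A) A))" if "\<beta> \<in> Lkn r n" for \<beta>
    using that finite_subset[of \<beta> "{..<n}"]
    by (intro hdet_hermitian qhermitian_gram) (auto simp: Lkn_def)
  then show ?thesis by (simp add: minor_sum_def)
qed

text \<open>With the inverse written as \<open>N\<^sub>r A\<^sup>* / d\<^sub>r\<close>, column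
  \<open>j\<close> of the product is \<open>N\<^sub>r\<close> applied to column \<open>j\<close> of
  \<open>A\<^sup>* C\<close>, and the rows of \<open>N\<^sub>r\<close> are the numerators
  \<open>cdet_sum\<close>.\<close>

theorem qMP_mult_eq:
  assumes "qrank m n A = r" "i < n"
  shows "qmult m (qMP m n A) C i j
    = (\<Sum>\<beta>\<in>Jkn r n i. cdet \<beta> (colrep (qmult m (qadj A) A) i (col (qmult m (qadj A) C) j)) i)
      / (\<Sum>\<beta>\<in>Lkn r n. hdet \<beta> (qmult m (qadj A) A))"
proof -
  let ?G = "qmult m (qadj A) A" and ?C = "qmult m (qadj A) C"
  \<comment> \<open>The width of \<open>C\<close> is not fixed here; \<open>Suc j\<close> columns
    are just enough to include column \<open>j\<close>.\<close>
  have "qmat_eq n (Suc j) (qmult m (qMP m n A) C)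
      (qmult m (qscale (1 / minor_sum r n ?G) (qmult n (faddeev n ?G r) (qadj A))) C)"
    unfolding assms(1)[symmetric] by (intro qmult_cong qmat_eq_refl qMP_eqI is_MP_faddeev)
  then have "qmult m (qMP m n A) C i j = (1 / minor_sum r n ?G) *\<^sub>R qmult n (faddeev n ?G r) ?C i j"
    using assms(2) unfolding qmult_qscale_left qmult_assoc by (simp add: qmat_eq_def qscale_def)
  also have "qmult n (faddeev n ?G r) ?C i j = cdet_sum r n ?G i (col ?C j)"
    unfolding cdet_sum_conv_faddeev[OF qhermitian_gram assms(2)] by (simp add: qmult_def col_def)
  finally show ?thesis unfolding sum_hdet_gram divide_of_real_quat cdet_sum_def .
qed

lemma divide_mult_divide_of_real_quat:
  "(x :: quat) / of_real c * (y / of_real d) = x * y / (of_real c * of_real d)"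
  unfolding of_real_mult[symmetric] divide_of_real_quat by simp

theorem theorem5p6:
  fixes m n p r r1 r4 :: nat and A1 A2 C :: qmat
  defines "M \<equiv> qmult m (qR m n A1) A2"
  defines "X1 \<equiv> qdiff (qmult m (qMP m n A1) C)
                      (qmult m (qmult p (qmult m (qMP m n A1) A2) (qMP m p M)) C)"
  defines "X2 \<equiv> qmult m (qMP m p M) C"
  defines "C1 \<equiv> qmult m (qadj A1) C"
  defines "C2 \<equiv> qmult m (qadj M) C"
  defines "AA \<equiv> qmult m (qadj A1) A1"
  defines "A12 \<equiv> qmult m (qadj A1) A2"
  defines "MM \<equiv> qmult m (qadj M) M"
  assumes "qrank m n A1 = r1"
    and "qrank m p M = r4"
  shows "(\<forall>i<n. \<forall>j<r. X1 i j =
            (\<Sum>\<beta>\<in>Jkn r1 n i. cdet \<beta> (colrep AA i (col C1 j)) i) / (\<Sum>\<beta>\<in>Lkn r1 n. hdet \<beta> AA)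
          - (\<Sum>t<p. (\<Sum>\<beta>\<in>Jkn r1 n i. cdet \<beta> (colrep AA i (col A12 t)) i)
                   * (\<Sum>\<beta>\<in>Jkn r4 p t. cdet \<beta> (colrep MM t (col C2 j)) t))
            / ((\<Sum>\<beta>\<in>Lkn r1 n. hdet \<beta> AA) * (\<Sum>\<beta>\<in>Lkn r4 p. hdet \<beta> MM)))
       \<and> (\<forall>g<p. \<forall>f<r. X2 g f =
            (\<Sum>\<beta>\<in>Jkn r4 p g. cdet \<beta> (colrep MM g (col C2 f)) g) / (\<Sum>\<beta>\<in>Lkn r4 p. hdet \<beta> MM))"
proof -
  let ?d1 = "\<Sum>\<beta>\<in>Lkn r1 n. hdet \<beta> AA" and ?d4 = "\<Sum>\<beta>\<in>Lkn r4 p. hdet \<beta> MM"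
  have X2: "X2 g f = (\<Sum>\<beta>\<in>Jkn r4 p g. cdet \<beta> (colrep MM g (col C2 f)) g) / ?d4" if "g < p" for g f
    unfolding X2_def MM_def C2_def using assms(10) that by (rule qMP_mult_eq)
  have A1: "qmult m (qMP m n A1) B i j
      = (\<Sum>\<beta>\<in>Jkn r1 n i. cdet \<beta> (colrep AA i (col (qmult m (qadj A1) B) j)) i) / ?d1"
    if "i < n" for B i j
    unfolding AA_def using assms(9) that by (rule qMP_mult_eq)
  \<comment> \<open>Real denominators are central, so the product of two quotients merges into one
    in spite of noncommutativity.\<close>
  obtain c d where cd: "?d1 = of_real c" "?d4 = of_real d"
    using sum_hdet_gram unfolding AA_def MM_def by blast
  have "X1 i j = (\<Sum>\<beta>\<in>Jkn r1 n i. cdet \<beta> (colrep AA i (col C1 j)) i) / ?d1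
      - (\<Sum>t<p. (\<Sum>\<beta>\<in>Jkn r1 n i. cdet \<beta> (colrep AA i (col A12 t)) i)
               * (\<Sum>\<beta>\<in>Jkn r4 p t. cdet \<beta> (colrep MM t (col C2 j)) t)) / (?d1 * ?d4)"
    if i: "i < n" for i j
  proof -
    \<comment> \<open>Reassociation exposes \<open>X2\<close> as the right factor of the subtracted
      term, so both factors are instances of \<open>qMP_mult_eq\<close>, with right-hand sides
      \<open>A2\<close> and \<open>C\<close>.\<close>
    have "X1 i j = qmult m (qMP m n A1) C i j
        - (\<Sum>t<p. qmult m (qMP m n A1) A2 i t * X2 t j)"
      unfolding X1_def X2_def qmult_assoc[of m p] by (simp add: qdiff_def qmult_def[of p])
    also have "(\<Sum>t<p. qmult m (qMP m n A1) A2 i t * X2 t j)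
        = (\<Sum>t<p. (\<Sum>\<beta>\<in>Jkn r1 n i. cdet \<beta> (colrep AA i (col A12 t)) i)
               * (\<Sum>\<beta>\<in>Jkn r4 p t. cdet \<beta> (colrep MM t (col C2 j)) t) / (?d1 * ?d4))"
      unfolding A12_def
      by (intro sum.cong refl)
        (simp only: A1[OF i] X2 lessThan_iff cd divide_mult_divide_of_real_quat)
    also have "\<dots> = (\<Sum>t<p. (\<Sum>\<beta>\<in>Jkn r1 n i. cdet \<beta> (colrep AA i (col A12 t)) i)
               * (\<Sum>\<beta>\<in>Jkn r4 p t. cdet \<beta> (colrep MM t (col C2 j)) t)) / (?d1 * ?d4)"
      by (simp only: divide_quat_def sum_distrib_right)
    finally show ?thesis unfolding A1[OF i] C1_def .
  qed
  then show ?thesis using X2 by blast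
qed

end
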